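(* Let $l\geq 1$ be an integer. Assume that $T_1, T_2, \ldots, T_l$ are commuting invertible ergodic measure preserving transformations of a probability space $(X, \mathcal{X}, \mu)$ such that $T_iT_j^{-1}$ is ergodic for all $i,j\in \{1, 2, \ldots, l\}$ with $i\neq j$. (i) If $f_1, f_2, \ldots, f_l\in L^\infty(\mu)$, then $$ \limsup_{N\to +\infty}\Big\|\frac{1}{N}\sum_{n=0}^{N-1}f_1(T_1^nx)\cdot f_2(T_2^nx)\cdot\ldots\cdot f_l(T_l^nx)\Big\|_{L^2(\mu)} \leq \min_{i=1, 2, \ldots, l}|\!|\!| f_i|\!|\!|_{l}, $$ where the seminorm $|\!|\!|\cdot|\!|\!|_l$ is taken with respect to any $T_i$, $i\in\{1, 2, \ldots, l\}$. (ii) The sub-$\sigma$-algebra $\mathcal{Z}_{l-1}$ is a characteristic factor for convergence (in $L^2(\mu)$) of the averages $$\frac{1}{N}\sum_{n=0}^{N-1}f_1(T_1^nx)\cdot f_2(T_2^nx)\cdot\ldots\cdot f_l(T_l^nx).$$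
   Context: Functions are real valued. Let $T$ be an ergodic measure preserving transformation of a probability space $(X,\mathcal{X},\mu)$. For an integer $k\geq 0$ let $X^{[k]}=X^{2^k}$ and $T^{[k]}=T\times\cdots\times T$ ($2^k$ times). Define probability measures $\mu^{[k]}_T$ on $X^{[k]}$, invariant under $T^{[k]}$, inductively: $\mu^{[0]}_T=\mu$; for $k\ge 0$ let $\mathcal{I}^{[k]}(T)$ be the $\sigma$-algebra of $T^{[k]}$-invariant subsets of $X^{[k]}$, and let $\mu^{[k+1]}_T$ be the relatively independent square of $\mu^{[k]}_T$ over $\mathcal{I}^{[k]}(T)$, i.e. for bounded functions $F',F''$ on $X^{[k]}$, $$\int_{X^{[k+1]}}F'(\mathbf{x}')F''(\mathbf{x}'')\,d\mu^{[k+1]}_T(\mathbf{x}',\mathbf{x}'')=\int_{X^{[k]}}\mathbb{E}(F'\mid\mathcal{I}^{[k]}(T))\,\mathbb{E}(F''\mid\mathcal{I}^{[k]}(T))\,d\mu^{[k]}_T .$$ For $f\in L^\infty(\mu)$ and $k\ge 1$, the seminorm $|\!|\!|f|\!|\!|_{k,T}\geq 0$ is defined by $$|\!|\!|f|\!|\!|_{k,T}^{2^k}=\int_{X^{[k]}}\prod_{j=0}^{2^k-1}f(x_j)\,d\mu^{[k]}_T(\mathbf{x})$$ (the right side is known to be nonnegative). For $k\geq 1$, $\mathcal{Z}_{k-1}(X,T)$ is the $T$-invariant sub-$\sigma$-algebra of $\mathcal{X}$ characterized by: for $f\in L^\infty(\mu)$, $\mathbb{E}(f\mid\mathcal{Z}_{k-1}(X,T))=0$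 if and only if $|\!|\!|f|\!|\!|_{k,T}=0$ (its existence is known). For commuting ergodic transformations $T_1,\ldots,T_l$, the seminorms $|\!|\!|\cdot|\!|\!|_{k,T_i}$ and the $\sigma$-algebras $\mathcal{Z}_k(X,T_i)$ do not depend on $i$, and are written $|\!|\!|\cdot|\!|\!|_k$ and $\mathcal{Z}_k$. A sub-$\sigma$-algebra $\mathcal{C}$ of $\mathcal{X}$ is a characteristic factor for $L^2(\mu)$-convergence of the averages $\frac{1}{N}\sum_{n=0}^{N-1}f_1(T_1^nx)\cdots f_l(T_l^nx)$ if $\mathcal{C}$ is $T_i$-invariant for $i=1,\ldots,l$ and these averages converge to $0$ in $L^2(\mu)$ whenever $f_1,\ldots,f_l\in L^\infty(\mu)$ and $\mathbb{E}(f_i\mid\mathcal{C})=0$ for some $i\in\{1,\ldots,l\}$.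
   Formalization: (i) as printed fails (l=2, f_1=1, f_2=2 gives 2≤1); proved instead with each |||f_i|||_l multiplied by the product of the sup norms of the other f_j, and as printed when all ‖f_i‖_∞≤1. The measures μ^{[k]} are assumed to exist. *)

theory Defs
  imports "HOL-Probability.Probability"
begin

section \<open>Measure preserving transformations\<close>

definition measure_preserving_map :: "'a measure \<Rightarrow> ('a \<Rightarrow> 'a) \<Rightarrow> bool" where
  "measure_preserving_map M T \<longleftrightarrow> T \<in> measurable M M \<and> distr M M T = M"

definition invertible_measure_preserving :: "'a measure \<Rightarrow> ('a \<Rightarrow> 'a) \<Rightarrow> bool" where
  "invertible_measure_preserving M T \<longleftrightarrow>
     measure_preserving_map M T \<and> bij_betw T (space M) (space M) \<and>
     inv_into (space M) T \<in> measurable M M"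

definition ergodic_map :: "'a measure \<Rightarrow> ('a \<Rightarrow> 'a) \<Rightarrow> bool" where
  "ergodic_map M T \<longleftrightarrow>
     measure_preserving_map M T \<and>
     (\<forall>A\<in>sets M. T -` A \<inter> space M = A \<longrightarrow> emeasure M A = 0 \<or> emeasure M A = 1)"

definition commuting_maps :: "'a measure \<Rightarrow> ('a \<Rightarrow> 'a) \<Rightarrow> ('a \<Rightarrow> 'a) \<Rightarrow> bool" where
  "commuting_maps M S T \<longleftrightarrow> (\<forall>x\<in>space M. S (T x) = T (S x))"


section \<open>Bounded functions and norms\<close>

definition Linf :: "'a measure \<Rightarrow> ('a \<Rightarrow> real) set" where
  "Linf M = {f \<in> borel_measurable M. \<exists>C. AE x in M. \<bar>f x\<bar> \<le> C}"

definition Linf_norm :: "'a measure \<Rightarrow> ('a \<Rightarrow> real) \<Rightarrow> real" where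
  "Linf_norm M f = Inf {C. 0 \<le> C \<and> (AE x in M. \<bar>f x\<bar> \<le> C)}"

definition L2_norm :: "'a measure \<Rightarrow> ('a \<Rightarrow> real) \<Rightarrow> real" where
  "L2_norm M f = sqrt (\<integral>x. (f x)\<^sup>2 \<partial>M)"


section \<open>Sub-sigma-algebras\<close>

text \<open>As in \<^const>\<open>real_cond_exp\<close>, a sub-sigma-algebra is represented by a measure with the same
  space; only its sets matter.\<close>

definition invariant_algebra :: "'b measure \<Rightarrow> ('b \<Rightarrow> 'b) \<Rightarrow> 'b measure" where
  "invariant_algebra N S = sigma (space N) {A \<in> sets N. S -` A \<inter> space N = A}"

text \<open>Equality of \<open>T\<inverse>C\<close> and \<open>C\<close> up to null sets: the sigma-algebras characterised by their
  conditional expectations below are only determined up to null sets.\<close>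

definition invariant_subalgebra :: "'a measure \<Rightarrow> ('a \<Rightarrow> 'a) \<Rightarrow> 'a measure \<Rightarrow> bool" where
  "invariant_subalgebra M T C \<longleftrightarrow>
     subalgebra M C \<and>
     (\<forall>A\<in>sets C. \<exists>B\<in>sets C. AE x in M. T x \<in> A \<longleftrightarrow> x \<in> B) \<and>
     (\<forall>B\<in>sets C. \<exists>A\<in>sets C. AE x in M. T x \<in> A \<longleftrightarrow> x \<in> B)"


section \<open>Cube measures and seminorms\<close>

text \<open>A point \<open>x\<close> of \<open>X\<^bsup>[k+1]\<^esup> = X\<^bsup>[k]\<^esup> \<times> X\<^bsup>[k]\<^esup>\<close> is a family indexed by \<open>{..<2 ^ (k + 1)}\<close>;
  its two halves are indexed by \<open>{..<2 ^ k}\<close> and by its translate by \<open>2 ^ k\<close>.\<close>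

definition cube_space :: "'a measure \<Rightarrow> nat \<Rightarrow> (nat \<Rightarrow> 'a) measure" where
  "cube_space M k = (\<Pi>\<^sub>M j\<in>{..<2 ^ k}. M)"

definition cube_map :: "nat \<Rightarrow> ('a \<Rightarrow> 'a) \<Rightarrow> (nat \<Rightarrow> 'a) \<Rightarrow> (nat \<Rightarrow> 'a)" where
  "cube_map k T x = (\<lambda>j\<in>{..<2 ^ k}. T (x j))"

definition first_half :: "nat \<Rightarrow> (nat \<Rightarrow> 'a) \<Rightarrow> (nat \<Rightarrow> 'a)" where
  "first_half k x = (\<lambda>j\<in>{..<2 ^ k}. x j)"

definition second_half :: "nat \<Rightarrow> (nat \<Rightarrow> 'a) \<Rightarrow> (nat \<Rightarrow> 'a)" where
  "second_half k x = (\<lambda>j\<in>{..<2 ^ k}. x (2 ^ k + j))"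

definition bounded_measurable :: "'b measure \<Rightarrow> ('b \<Rightarrow> real) set" where
  "bounded_measurable N = {F \<in> borel_measurable N. \<exists>C. \<forall>x\<in>space N. \<bar>F x\<bar> \<le> C}"

text \<open>\<open>N'\<close> is the relatively independent square of the measure \<open>N\<close> on \<open>X\<^bsup>[k]\<^esup>\<close> over the
  \<open>T\<^bsup>[k]\<^esup>\<close>-invariant sets.\<close>

definition is_relative_square ::
  "'a measure \<Rightarrow> ('a \<Rightarrow> 'a) \<Rightarrow> nat \<Rightarrow> (nat \<Rightarrow> 'a) measure \<Rightarrow> (nat \<Rightarrow> 'a) measure \<Rightarrow> bool" where
  "is_relative_square M T k N N' \<longleftrightarrow>
     prob_space N' \<and> sets N' = sets (cube_space M (Suc k)) \<and>
     (\<forall>F\<in>bounded_measurable N. \<forall>G\<in>bounded_measurable N.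
        (\<integral>x. F (first_half k x) * G (second_half k x) \<partial>N') =
        (\<integral>x. real_cond_exp N (invariant_algebra N (cube_map k T)) F x *
              real_cond_exp N (invariant_algebra N (cube_map k T)) G x \<partial>N))"

lemma is_relative_square_unique:
  assumes N: "sets N = sets (cube_space M k)"
    and P: "is_relative_square M T k N P" and Q: "is_relative_square M T k N Q"
  shows "P = Q"
proof -
  have eq: "emeasure P' (Pi\<^sub>E {..<2 ^ Suc k} A) = ennreal (\<integral>x.
       real_cond_exp N (invariant_algebra N (cube_map k T)) (indicator (Pi\<^sub>E {..<2 ^ k} A)) x *
       real_cond_exp N (invariant_algebra N (cube_map k T))
         (indicator (\<Pi>\<^sub>E j\<in>{..<2 ^ k}. A (2 ^ k + j))) x \<partial>N)" (is "_ = ennreal ?c")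
    if A: "\<And>j. j \<in> {..<2 ^ Suc k} \<Longrightarrow> A j \<in> sets M" and P': "is_relative_square M T k N P'"
    for A P'
  proof -
    interpret P': prob_space P' using P' by (simp add: is_relative_square_def)
    have sets_P': "sets P' = sets (cube_space M (Suc k))"
      using P' by (simp add: is_relative_square_def)
    have ind: "indicator (Pi\<^sub>E {..<2 ^ k} B) \<in> bounded_measurable N"
      if "\<And>j. j < 2 ^ k \<Longrightarrow> B j \<in> sets M" for B
    proof -
      have "Pi\<^sub>E {..<2 ^ k} B \<in> sets N"
        using that by (auto simp: N cube_space_def intro!: sets_PiM_I_finite)
      thus ?thesis by (auto simp: bounded_measurable_def indicator_def intro!: exI[of _ 1])
    qed
    have rect: "Pi\<^sub>E {..<2 ^ Suc k} A \<in> sets P'"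
      using A by (auto simp: sets_P' cube_space_def intro!: sets_PiM_I_finite)
    have "P'.prob (Pi\<^sub>E {..<2 ^ Suc k} A) = (\<integral>x. indicator (Pi\<^sub>E {..<2 ^ Suc k} A) x \<partial>P')"
      using rect by simp
    also have "\<dots> = (\<integral>x. indicator (Pi\<^sub>E {..<2 ^ k} A) (first_half k x) *
        indicator (\<Pi>\<^sub>E j\<in>{..<2 ^ k}. A (2 ^ k + j)) (second_half k x) \<partial>P')"
    proof (rule Bochner_Integration.integral_cong[OF refl])
      fix x assume "x \<in> space P'"
      hence x: "x \<in> extensional {..<2 ^ Suc k}"
        using sets_eq_imp_space_eq[OF sets_P'] by (auto simp: cube_space_def space_PiM PiE_def)
      have "(\<forall>j<2 ^ Suc k. x j \<in> A j) \<longleftrightarrow>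
          (\<forall>j<2 ^ k. x j \<in> A j) \<and> (\<forall>j<2 ^ k. x (2 ^ k + j) \<in> A (2 ^ k + j))" (is "?l \<longleftrightarrow> ?r")
      proof
        assume ?r
        show ?l
        proof (intro allI impI)
          fix j :: nat assume "j < 2 ^ Suc k"
          then show "x j \<in> A j"
            using \<open>?r\<close> by (cases "j < 2 ^ k") (auto dest!: spec[of _ "j - 2 ^ k"])
        qed
      qed auto
      thus "indicator (Pi\<^sub>E {..<2 ^ Suc k} A) x =
        (indicator (Pi\<^sub>E {..<2 ^ k} A) (first_half k x) *
        indicator (\<Pi>\<^sub>E j\<in>{..<2 ^ k}. A (2 ^ k + j)) (second_half k x) :: real)"
        using x by (auto simp: indicator_def PiE_iff first_half_def second_half_def)
    qed
    also have "\<dots> = ?c"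
      using P' ind[of A] ind[of "\<lambda>j. A (2 ^ k + j)"] A unfolding is_relative_square_def by auto
    finally show ?thesis by (simp add: P'.emeasure_eq_measure)
  qed
  have sP: "sets P = sets (cube_space M (Suc k))" "sets Q = sets (cube_space M (Suc k))"
    using P Q by (simp_all add: is_relative_square_def)
  interpret P: prob_space P using P by (simp add: is_relative_square_def)
  show ?thesis
  proof (rule measure_eqI_PiM_finite)
    show "finite {..<2 ^ Suc k :: nat}" by simp
    show "sets P = sets (\<Pi>\<^sub>M j\<in>{..<2 ^ Suc k}. M)" "sets Q = sets (\<Pi>\<^sub>M j\<in>{..<2 ^ Suc k}. M)"
      using sP by (simp_all add: cube_space_def)
    show "emeasure P (Pi\<^sub>E {..<2 ^ Suc k} A) = emeasure Q (Pi\<^sub>E {..<2 ^ Suc k} A)"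
      if "\<And>j. j \<in> {..<2 ^ Suc k} \<Longrightarrow> A j \<in> sets M" for A
      using eq[OF that P] eq[OF that Q] by simp
    show "range (\<lambda>n::nat. \<Pi>\<^sub>E j\<in>{..<2 ^ Suc k :: nat}. space M) \<subseteq> prod_algebra {..<2 ^ Suc k :: nat} (\<lambda>j. M)"
      by (auto intro!: prod_algebraI_finite)
    show "(\<Union>n::nat. \<Pi>\<^sub>E j\<in>{..<2 ^ Suc k :: nat}. space M) = space (\<Pi>\<^sub>M j\<in>{..<2 ^ Suc k}. M)"
      by (simp add: space_PiM)
    show "emeasure P (\<Pi>\<^sub>E j\<in>{..<2 ^ Suc k :: nat}. space M) \<noteq> \<infinity>" by simp
  qed
qed

primrec cube_measure :: "'a measure \<Rightarrow> ('a \<Rightarrow> 'a) \<Rightarrow> nat \<Rightarrow> (nat \<Rightarrow> 'a) measure" where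
  "cube_measure M T 0 = distr M (cube_space M 0) (\<lambda>x. \<lambda>j\<in>{..<2 ^ 0}. x)"
| "cube_measure M T (Suc k) = (THE N'. is_relative_square M T k (cube_measure M T k) N')"

text \<open>Relatively independent squares are unique by \<open>is_relative_square_unique\<close>, but their existence
  needs some regularity of the probability space (it holds on standard Borel spaces, and may fail
  in general). The following says that the inductive definition of the cube measures makes sense.\<close>

definition has_cube_measures :: "'a measure \<Rightarrow> ('a \<Rightarrow> 'a) \<Rightarrow> bool" where
  "has_cube_measures M T \<longleftrightarrow> (\<forall>k. \<exists>N'. is_relative_square M T k (cube_measure M T k) N')"

lemma is_relative_square_cube_measure:
  assumes "has_cube_measures M T"
  shows "sets (cube_measure M T k) = sets (cube_space M k)"
    and "is_relative_square M T k (cube_measure M T k) (cube_measure M T (Suc k))"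
proof -
  have *: "is_relative_square M T k (cube_measure M T k) (cube_measure M T (Suc k))"
    if "sets (cube_measure M T k) = sets (cube_space M k)" for k
  proof -
    obtain N' where "is_relative_square M T k (cube_measure M T k) N'"
      using assms unfolding has_cube_measures_def by blast
    thus ?thesis
      by (auto intro!: theI[where a = N'] is_relative_square_unique[OF that])
  qed
  show sets: "sets (cube_measure M T k) = sets (cube_space M k)"
    using *[unfolded is_relative_square_def] by (induction k) auto
  show "is_relative_square M T k (cube_measure M T k) (cube_measure M T (Suc k))"
    by (rule *[OF sets])
qed

definition cube_seminorm :: "'a measure \<Rightarrow> ('a \<Rightarrow> 'a) \<Rightarrow> nat \<Rightarrow> ('a \<Rightarrow> real) \<Rightarrow> real" where
  "cube_seminorm M T k f =
     root (2 ^ k) (\<integral>x. (\<Prod>j<2 ^ k. f (x j)) \<partial>cube_measure M T k)"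

text \<open>\<open>Z\<close> is (a version of) the factor \<open>\<Z>\<^sub>k(X,T)\<close>, which corresponds to the seminorm of index
  \<open>k + 1\<close>.\<close>

definition is_Z_factor :: "'a measure \<Rightarrow> ('a \<Rightarrow> 'a) \<Rightarrow> nat \<Rightarrow> 'a measure \<Rightarrow> bool" where
  "is_Z_factor M T k Z \<longleftrightarrow>
     invariant_subalgebra M T Z \<and>
     (\<forall>f\<in>Linf M. (AE x in M. real_cond_exp M Z f x = 0) \<longleftrightarrow> cube_seminorm M T (Suc k) f = 0)"


section \<open>Multiple ergodic averages\<close>

definition multiple_average ::
  "nat \<Rightarrow> (nat \<Rightarrow> 'a \<Rightarrow> 'a) \<Rightarrow> (nat \<Rightarrow> 'a \<Rightarrow> real) \<Rightarrow> nat \<Rightarrow> 'a \<Rightarrow> real" where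
  "multiple_average l T f N x = (1 / real N) * (\<Sum>n<N. \<Prod>i=1..l. f i ((T i ^^ n) x))"

definition characteristic_factor ::
  "'a measure \<Rightarrow> nat \<Rightarrow> (nat \<Rightarrow> 'a \<Rightarrow> 'a) \<Rightarrow> 'a measure \<Rightarrow> bool" where
  "characteristic_factor M l T C \<longleftrightarrow>
     (\<forall>i\<in>{1..l}. invariant_subalgebra M (T i) C) \<and>
     (\<forall>f. (\<forall>i\<in>{1..l}. f i \<in> Linf M) \<longrightarrow>
          (\<exists>i\<in>{1..l}. AE x in M. real_cond_exp M C (f i) x = 0) \<longrightarrow>
          (\<lambda>N. L2_norm M (multiple_average l T f N)) \<longlonglongrightarrow> 0)"

end

theory Submission
  imports Defs
begin

text \<open>Fix \<open>T = T\<^sub>p\<close>, and write \<open>C\<^sub>k(f)\<close> for the integral of \<open>\<Prod>\<^sub>j f(x\<^sub>j)\<close> over the cube measure of \<open>T\<close>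
  of order \<open>k\<close>, so that the seminorm of order \<open>k\<close> is the \<open>2\<^sup>k\<close>-th root of \<open>C\<^sub>k(f)\<close>, and, for a map \<open>S\<close>,
  \<open>D\<^sub>k(S, f, H) = H\<^sup>-\<^sup>2 \<Sum>\<^bsub>a,b<H\<^esub> C\<^sub>k(f \<circ> S\<^sup>a \<cdot> f \<circ> S\<^sup>b)\<close>.
  The mean ergodic theorem on \<open>X\<^bsup>[k]\<^esup>\<close> says that \<open>C\<^bsub>k+1\<^esub>(f)\<close> is both the limit in \<open>H\<close> and a lower
  bound of \<open>D\<^sub>k(T, f, H)\<close>. No cube measures of maps other than \<open>T\<close> are needed: if \<open>S\<close> is ergodic and
  commutes with \<open>T\<close>, then \<open>limsup\<^sub>H D\<^sub>k(S, f, H) \<le> C\<^bsub>k+1\<^esub>(f)\<close>. Indeed the lower bound and commutativity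
  give \<open>D\<^bsub>k+1\<^esub>(S, f, H) \<le> n\<^sup>-\<^sup>2 \<Sum>\<^bsub>i,j<n\<^esub> D\<^sub>k(S, f \<circ> T\<^sup>i \<cdot> f \<circ> T\<^sup>j, H)\<close>, and one lets first \<open>H\<close> and then
  \<open>n\<close> tend to infinity.

  The bound for the averages follows by induction on the number of transformations, for families that
  need not contain \<open>T\<close> but commute with it. To bound by the seminorm of \<open>f\<^sub>i\<close>, choose \<open>r \<noteq> i\<close>; the
  van der Corput inequality and the invariance of \<open>\<mu>\<close> under \<open>T\<^sub>r\<close> lead to averages along the maps
  \<open>T\<^sub>j T\<^sub>r\<inverse>\<close>, \<open>j \<noteq> r\<close>, of the functions \<open>f\<^sub>j \<circ> T\<^sub>j\<^sup>a \<cdot> f\<^sub>j \<circ> T\<^sub>j\<^sup>b\<close>, and the seminorms of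
  \<open>f\<^sub>i \<circ> T\<^sub>i\<^sup>a \<cdot> f\<^sub>i \<circ> T\<^sub>i\<^sup>b\<close> are averaged by the previous inequality for \<open>S = T\<^sub>i\<close>.\<close>

section \<open>Bounded measurable functions\<close>

lemma bounded_measurable_measurable [measurable_dest]:
  "F \<in> bounded_measurable N \<Longrightarrow> F \<in> borel_measurable N"
  by (simp add: bounded_measurable_def)

lemma bounded_measurableE:
  assumes "F \<in> bounded_measurable N"
  obtains B where "B \<ge> 0" "\<And>x. x \<in> space N \<Longrightarrow> \<bar>F x\<bar> \<le> B"
proof -
  obtain C where "\<forall>x\<in>space N. \<bar>F x\<bar> \<le> C" using assms by (auto simp: bounded_measurable_def)
  then show thesis by (intro that[of "max 0 C"]) fastforce+
qed

lemma bounded_measurable_const [intro]: "(\<lambda>x. c) \<in> bounded_measurable N"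
  by (auto simp: bounded_measurable_def)

lemma bounded_measurable_mult [intro]:
  assumes "F \<in> bounded_measurable N" "G \<in> bounded_measurable N"
  shows "(\<lambda>x. F x * G x) \<in> bounded_measurable N"
proof -
  obtain B where B: "B \<ge> 0" "\<And>x. x \<in> space N \<Longrightarrow> \<bar>F x\<bar> \<le> B"
    using assms(1) by (rule bounded_measurableE) blast
  obtain C where C: "C \<ge> 0" "\<And>x. x \<in> space N \<Longrightarrow> \<bar>G x\<bar> \<le> C"
    using assms(2) by (rule bounded_measurableE) blast
  note [measurable] = assms
  show ?thesis unfolding bounded_measurable_def
  proof (safe intro!: exI[of _ "B * C"])
    fix x assume "x \<in> space N"
    then show "\<bar>F x * G x\<bar> \<le> B * C" using B C by (simp add: abs_mult mult_mono)
  qed measurable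
qed

lemma bounded_measurable_add [intro]:
  assumes "F \<in> bounded_measurable N" "G \<in> bounded_measurable N"
  shows "(\<lambda>x. F x + G x) \<in> bounded_measurable N"
proof -
  obtain B where B: "B \<ge> 0" "\<And>x. x \<in> space N \<Longrightarrow> \<bar>F x\<bar> \<le> B"
    using assms(1) by (rule bounded_measurableE) blast
  obtain C where C: "C \<ge> 0" "\<And>x. x \<in> space N \<Longrightarrow> \<bar>G x\<bar> \<le> C"
    using assms(2) by (rule bounded_measurableE) blast
  note [measurable] = assms
  show ?thesis unfolding bounded_measurable_def
  proof (safe intro!: exI[of _ "B + C"])
    fix x assume "x \<in> space N"
    then show "\<bar>F x + G x\<bar> \<le> B + C" using B C by (meson abs_triangle_ineq add_mono order_trans)
  qed measurable
qed

lemma bounded_measurable_diff [intro]: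
  assumes "F \<in> bounded_measurable N" "G \<in> bounded_measurable N"
  shows "(\<lambda>x. F x - G x) \<in> bounded_measurable N"
  using bounded_measurable_add[OF assms(1)
      bounded_measurable_mult[OF bounded_measurable_const[of "-1"] assms(2)]] by simp

lemma bounded_measurable_sum [intro]:
  "(\<And>i. i \<in> I \<Longrightarrow> F i \<in> bounded_measurable N) \<Longrightarrow> (\<lambda>x. \<Sum>i\<in>I. F i x) \<in> bounded_measurable N"
  by (induction I rule: infinite_finite_induct) auto

lemma bounded_measurable_prod [intro]:
  "(\<And>i. i \<in> I \<Longrightarrow> F i \<in> bounded_measurable N) \<Longrightarrow> (\<lambda>x. \<Prod>i\<in>I. F i x) \<in> bounded_measurable N"
  by (induction I rule: infinite_finite_induct) auto

lemma bounded_measurable_power2 [intro]: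
  "F \<in> bounded_measurable N \<Longrightarrow> (\<lambda>x. (F x)\<^sup>2) \<in> bounded_measurable N"
  unfolding power2_eq_square by auto

lemma bounded_measurable_comp:
  assumes "F \<in> bounded_measurable N" "S \<in> measurable K N"
  shows "(\<lambda>x. F (S x)) \<in> bounded_measurable K"
proof -
  have "(\<lambda>x. F (S x)) \<in> borel_measurable K"
    using measurable_compose[OF assms(2) bounded_measurable_measurable[OF assms(1)]] .
  then show ?thesis
    using assms(1) measurable_space[OF assms(2)] by (auto simp: bounded_measurable_def)
qed

lemma integrable_bounded_measurable:
  assumes "prob_space N" "F \<in> bounded_measurable N"
  shows "integrable N F"
proof -
  interpret prob_space N by fact
  obtain B where "\<And>x. x \<in> space N \<Longrightarrow> \<bar>F x\<bar> \<le> B"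
    using assms(2) by (rule bounded_measurableE) blast
  then show ?thesis using assms(2)
    by (intro integrable_const_bound[of _ B]) (auto simp: bounded_measurable_def)
qed

lemma integral_le_const_bounded:
  assumes "prob_space N" "F \<in> bounded_measurable N" "\<And>x. x \<in> space N \<Longrightarrow> F x \<le> c"
  shows "(\<integral>x. F x \<partial>N) \<le> c"
proof -
  interpret prob_space N by fact
  show ?thesis using integrable_bounded_measurable[OF assms(1,2)] assms(3)
    by (intro integral_le_const) auto
qed

text \<open>Nonnegativity of the variance.\<close>

lemma integral_square_ge:
  assumes "prob_space N" "F \<in> bounded_measurable N"
  shows "(\<integral>x. F x \<partial>N)\<^sup>2 \<le> (\<integral>x. (F x)\<^sup>2 \<partial>N)"
proof -
  interpret prob_space N by fact
  show ?thesis using variance_eq[of F] variance_positive[of F] assms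
    by (simp add: integrable_bounded_measurable bounded_measurable_power2)
qed

lemma integral_abs_le_sqrt:
  assumes "prob_space N" "F \<in> bounded_measurable N"
  shows "(\<integral>x. \<bar>F x\<bar> \<partial>N) \<le> sqrt (\<integral>x. (F x)\<^sup>2 \<partial>N)"
proof -
  have "(\<lambda>x. \<bar>F x\<bar>) \<in> bounded_measurable N" using assms(2) by (auto simp: bounded_measurable_def)
  from integral_square_ge[OF assms(1) this] show ?thesis
    by (intro real_le_rsqrt) simp
qed

section \<open>Iterates of measure preserving maps\<close>

lemma measure_preserving_funpow:
  assumes "measure_preserving_map N S"
  shows "measure_preserving_map N (S ^^ n)"
proof (induction n)
  case 0
  then show ?case by (simp add: measure_preserving_map_def id_def distr_id)
next
  case (Suc n)
  then have "distr N N (S \<circ> (S ^^ n)) = distr (distr N N (S ^^ n)) N S"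
    using assms unfolding measure_preserving_map_def by (subst distr_distr) auto
  with Suc assms show ?case unfolding measure_preserving_map_def by auto
qed

lemma measure_preserving_funpow_space:
  assumes "measure_preserving_map N S" "x \<in> space N"
  shows "(S ^^ n) x \<in> space N"
  using measure_preserving_funpow[OF assms(1), of n] assms(2)
  by (auto simp: measure_preserving_map_def dest: measurable_space)

lemma bounded_measurable_funpow:
  assumes "measure_preserving_map N S" "F \<in> bounded_measurable N"
  shows "(\<lambda>x. F ((S ^^ n) x)) \<in> bounded_measurable N"
  using bounded_measurable_comp[OF assms(2)] measure_preserving_funpow[OF assms(1)]
  by (auto simp: measure_preserving_map_def)

lemma integral_measure_preserving:
  fixes G :: "'a \<Rightarrow> real"
  assumes "measure_preserving_map N S" "G \<in> borel_measurable N"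
  shows "(\<integral>x. G (S x) \<partial>N) = (\<integral>x. G x \<partial>N)"
  using assms integral_distr[of S N N G] by (simp add: measure_preserving_map_def)

section \<open>The mean ergodic theorem\<close>

text \<open>For \<open>n = 0\<close> division by zero makes the value \<open>0\<close>; hence the
  assumptions \<open>n \<ge> 1\<close> where an average has to reflect \<open>F\<close>.\<close>

definition ergodic_average :: "('a \<Rightarrow> 'a) \<Rightarrow> ('a \<Rightarrow> real) \<Rightarrow> nat \<Rightarrow> 'a \<Rightarrow> real" where
  "ergodic_average S F n x = (1 / real n) * (\<Sum>k<n. F ((S ^^ k) x))"

text \<open>Moving the window by one place replaces a single term by another one and so costs at
  most \<open>2 * B\<close>; this happens \<open>h\<close> times.\<close>

lemma sum_shift_bound:
  fixes u :: "nat \<Rightarrow> real"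
  assumes "\<And>n. \<bar>u n\<bar> \<le> B"
  shows "\<bar>(\<Sum>n<K. u (n + h)) - (\<Sum>n<K. u n)\<bar> \<le> 2 * real h * B"
proof (induction h)
  case (Suc h)
  have "(\<Sum>n<K. u (n + Suc h)) - (\<Sum>n<K. u (n + h)) = u (K + h) - u h"
    using sum_lessThan_telescope[of "\<lambda>n. u (n + h)" K] by (simp add: sum_subtractf)
  then show ?case using Suc assms[of "K + h"] assms[of h] by (simp add: algebra_simps abs_le_iff)
qed simp

lemma square_average_le:
  fixes u :: "nat \<Rightarrow> real"
  shows "((1 / real K) * (\<Sum>n<K. u n))\<^sup>2 \<le> (1 / real K) * (\<Sum>n<K. (u n)\<^sup>2)"
proof (cases "K = 0")
  case False
  have "(\<Sum>n<K. u n)\<^sup>2 \<le> (\<Sum>n<K. (u n)\<^sup>2) * real K"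
    using sum_squared_le_sum_of_squares[of u "{..<K}"] by simp
  then show ?thesis using False
    by (simp add: power_divide divide_simps power2_eq_square)
qed simp

lemma abs_average_le:
  fixes u :: "nat \<Rightarrow> real"
  assumes "\<And>n. \<bar>u n\<bar> \<le> B" "0 \<le> B"
  shows "\<bar>(1 / real K) * (\<Sum>n<K. u n)\<bar> \<le> B"
proof (cases "K = 0")
  case False
  have "\<bar>\<Sum>n<K. u n\<bar> \<le> (\<Sum>n<K. \<bar>u n\<bar>)" by (rule sum_abs)
  also have "\<dots> \<le> real K * B" using sum_bounded_above[of "{..<K}" "\<lambda>n. \<bar>u n\<bar>" B] assms by simp
  finally show ?thesis using False by (simp add: abs_mult field_simps)
qed (use assms in simp)

lemma bounded_measurable_ergodic_average:
  assumes "measure_preserving_map N S" "F \<in> bounded_measurable N"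
  shows "ergodic_average S F n \<in> bounded_measurable N"
proof -
  have "(\<lambda>x. (1 / real n) * (\<Sum>k<n. F ((S ^^ k) x))) \<in> bounded_measurable N"
    using bounded_measurable_funpow[OF assms] by (intro bounded_measurable_mult bounded_measurable_sum) auto
  then show ?thesis unfolding ergodic_average_def[abs_def] .
qed

text \<open>Convexity bounds the squared average pointwise by the average of the squares, whose
  terms all have the same integral by invariance.\<close>

lemma integral_ergodic_average_square_le:
  assumes N: "prob_space N" and S: "measure_preserving_map N S" and F: "F \<in> bounded_measurable N"
  shows "(\<integral>x. (ergodic_average S F n x)\<^sup>2 \<partial>N) \<le> (\<integral>x. (F x)\<^sup>2 \<partial>N)"
proof -
  have F2: "(\<lambda>x. (F x)\<^sup>2) \<in> bounded_measurable N" using F by auto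
  have F2n: "(\<lambda>x. (F ((S ^^ k) x))\<^sup>2) \<in> bounded_measurable N" for k
    using bounded_measurable_funpow[OF S F] by auto
  have "(\<integral>x. (ergodic_average S F n x)\<^sup>2 \<partial>N) \<le> (\<integral>x. (1 / real n) * (\<Sum>k<n. (F ((S ^^ k) x))\<^sup>2) \<partial>N)"
  proof (intro integral_mono integrable_bounded_measurable[OF N])
    show "(\<lambda>x. (ergodic_average S F n x)\<^sup>2) \<in> bounded_measurable N"
      by (intro bounded_measurable_power2 bounded_measurable_ergodic_average[OF S F])
    show "(\<lambda>x. (1 / real n) * (\<Sum>k<n. (F ((S ^^ k) x))\<^sup>2)) \<in> bounded_measurable N"
      by (intro bounded_measurable_mult bounded_measurable_sum F2n) auto
  qed (unfold ergodic_average_def, rule square_average_le)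
  also have "\<dots> = (1 / real n) * (\<Sum>k<n. \<integral>x. (F ((S ^^ k) x))\<^sup>2 \<partial>N)"
    using integrable_bounded_measurable[OF N F2n] by simp
  also have "\<dots> = (1 / real n) * (\<Sum>k<n. \<integral>x. (F x)\<^sup>2 \<partial>N)"
    using integral_measure_preserving[OF measure_preserving_funpow[OF S] bounded_measurable_measurable[OF F2]]
    by simp
  also have "\<dots> \<le> (\<integral>x. (F x)\<^sup>2 \<partial>N)" by simp
  finally show ?thesis .
qed

text \<open>Written out, the iterated average is the mean over \<open>i < n\<close> of the averages
  of length \<open>k\<close> started at place \<open>i\<close>, and moving the start by less than
  \<open>n\<close> places costs at most \<open>2 * real n * B / real k\<close>.\<close>

lemma ergodic_average_twice:
  assumes S: "measure_preserving_map N S" and B: "\<And>x. x \<in> space N \<Longrightarrow> \<bar>F x\<bar> \<le> B"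
    and n: "n \<ge> 1" and x: "x \<in> space N"
  shows "\<bar>ergodic_average S (ergodic_average S F n) k x - ergodic_average S F k x\<bar>
           \<le> 2 * real n * B / real k"
proof (cases "k = 0")
  case False
  let ?u = "\<lambda>j. F ((S ^^ j) x)"
  have u: "\<bar>?u j\<bar> \<le> B" for j using B measure_preserving_funpow_space[OF S x] by auto
  have funpow_twice: "(S ^^ i) ((S ^^ j) x) = (S ^^ (j + i)) x" for i j
    by (subst add.commute) (simp add: funpow_add)
  have "ergodic_average S (ergodic_average S F n) k x =
      (1 / real k) * (\<Sum>j<k. (1 / real n) * (\<Sum>i<n. ?u (j + i)))"
    using funpow_twice by (simp add: ergodic_average_def)
  also have "\<dots> = (1 / real k) * ((1 / real n) * (\<Sum>i<n. \<Sum>j<k. ?u (j + i)))"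
    by (simp only: sum_distrib_left[symmetric]) (subst sum.swap, simp)
  finally have 1: "ergodic_average S (ergodic_average S F n) k x =
      (1 / real k) * ((1 / real n) * (\<Sum>i<n. \<Sum>j<k. ?u (j + i)))" .
  have "\<bar>(\<Sum>i<n. \<Sum>j<k. ?u (j + i)) - (\<Sum>i<n. \<Sum>j<k. ?u j)\<bar> \<le> (\<Sum>i<n. 2 * real n * B)"
    unfolding sum_subtractf[symmetric]
  proof (rule order_trans[OF sum_abs], rule sum_mono)
    fix i assume "i \<in> {..<n}"
    have "\<bar>\<Sum>j<k. ?u (j + i) - ?u j\<bar> \<le> 2 * real i * B"
      using sum_shift_bound[of ?u B i k] u by (simp add: sum_subtractf)
    also have "\<dots> \<le> 2 * real n * B"
      using \<open>i \<in> {..<n}\<close> u[of 0] by (intro mult_right_mono) auto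
    finally show "\<bar>\<Sum>j<k. ?u (j + i) - ?u j\<bar> \<le> 2 * real n * B" .
  qed
  then have bound: "\<bar>(\<Sum>i<n. \<Sum>j<k. ?u (j + i)) - real n * (\<Sum>j<k. ?u j)\<bar> \<le> real n * (2 * real n * B)"
    by simp
  have "ergodic_average S (ergodic_average S F n) k x - ergodic_average S F k x =
     ((\<Sum>i<n. \<Sum>j<k. ?u (j + i)) - real n * (\<Sum>j<k. ?u j)) / (real n * real k)"
    using n False unfolding 1 by (simp add: ergodic_average_def field_simps)
  then have "\<bar>ergodic_average S (ergodic_average S F n) k x - ergodic_average S F k x\<bar>
      = \<bar>(\<Sum>i<n. \<Sum>j<k. ?u (j + i)) - real n * (\<Sum>j<k. ?u j)\<bar> / (real n * real k)"
    by (simp only: abs_divide abs_mult abs_of_nat)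
  also have "\<dots> \<le> (real n * (2 * real n * B)) / (real n * real k)"
    by (intro divide_right_mono bound) simp
  also have "\<dots> = 2 * real n * B / real k" using n by simp
  finally show ?thesis .
qed (simp add: ergodic_average_def)

text \<open>The averages of length \<open>k\<close> of \<open>F\<close> and of the midpoint
  \<open>G\<close> differ by \<open>O(1/k)\<close> uniformly, and averaging does not increase the
  \<open>L^2\<close> norm. So the norm of a midpoint of two averages is, up to a vanishing error, an
  upper bound for the norms of all long averages.\<close>

lemma ergodic_average_square_midpoint:
  assumes N: "prob_space N" and S: "measure_preserving_map N S" and F: "F \<in> bounded_measurable N"
    and m: "m \<ge> 1" and n: "n \<ge> 1"
  shows "\<exists>c. \<forall>k. (\<integral>x. (ergodic_average S F k x)\<^sup>2 \<partial>N) \<le>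
      (\<integral>x. ((ergodic_average S F m x + ergodic_average S F n x) / 2)\<^sup>2 \<partial>N) + c / real k"
proof -
  obtain B where B: "B \<ge> 0" "\<And>x. x \<in> space N \<Longrightarrow> \<bar>F x\<bar> \<le> B"
    using F by (rule bounded_measurableE) blast
  let ?A = "ergodic_average S"
  define G where "G x = 1/2 * (?A F m x + ?A F n x)" for x
  have A: "?A F k \<in> bounded_measurable N" for k by (rule bounded_measurable_ergodic_average[OF S F])
  have G: "G \<in> bounded_measurable N" unfolding G_def[abs_def]
    by (intro bounded_measurable_mult bounded_measurable_add A) auto
  have AG: "?A G k \<in> bounded_measurable N" for k by (rule bounded_measurable_ergodic_average[OF S G])
  have Abd: "\<bar>?A F k x\<bar> \<le> B" if "x \<in> space N" for k x
    unfolding ergodic_average_def using B measure_preserving_funpow_space[OF S that]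
    by (intro abs_average_le) auto
  have Gbd: "\<bar>G x\<bar> \<le> B" if "x \<in> space N" for x
    using Abd[OF that, of m] Abd[OF that, of n] by (simp add: G_def abs_le_iff)
  have AGbd: "\<bar>?A G k x\<bar> \<le> B" if "x \<in> space N" for k x
    unfolding ergodic_average_def[of S G] using Gbd B measure_preserving_funpow_space[OF S that]
    by (intro abs_average_le) auto
  \<comment> \<open>The mean of the errors \<open>2 * m * B\<close> and \<open>2 * n * B\<close>
    that \<open>ergodic_average_twice\<close> gives for the two lengths.\<close>
  define e where "e = real m * B + real n * B"
  have "e \<ge> 0" using B by (simp add: e_def)
  have near: "\<bar>?A F k x - ?A G k x\<bar> \<le> e / real k" if x: "x \<in> space N" for k x
  proof -
    have "?A G k x = 1/2 * (?A (?A F m) k x + ?A (?A F n) k x)"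
      unfolding ergodic_average_def[of S G] ergodic_average_def[of S "?A F m"]
        ergodic_average_def[of S "?A F n"] G_def sum_distrib_left[symmetric] sum.distrib
      by (simp add: algebra_simps)
    moreover have "\<bar>?A (?A F m) k x - ?A F k x\<bar> \<le> 2 * (real m * B / real k)"
      using ergodic_average_twice[OF S _ m x, of F B k] B(2) by simp
    moreover have "\<bar>?A (?A F n) k x - ?A F k x\<bar> \<le> 2 * (real n * B / real k)"
      using ergodic_average_twice[OF S _ n x, of F B k] B(2) by simp
    ultimately show ?thesis by (simp add: e_def add_divide_distrib abs_le_iff)
  qed
  have "(\<integral>x. (?A F k x)\<^sup>2 \<partial>N) \<le> (\<integral>x. (G x)\<^sup>2 \<partial>N) + (2 * B * e) / real k" for k
  proof -
    have pt: "(?A F k x)\<^sup>2 - (?A G k x)\<^sup>2 \<le> (2 * B * e) / real k" if x: "x \<in> space N" for x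
    proof -
      have "(?A F k x)\<^sup>2 - (?A G k x)\<^sup>2 \<le> \<bar>?A F k x + ?A G k x\<bar> * \<bar>?A F k x - ?A G k x\<bar>"
        by (simp add: abs_mult[symmetric] power2_eq_square algebra_simps)
      also have "\<dots> \<le> (2 * B) * (e / real k)"
        using near[OF x] Abd[OF x, of k] AGbd[OF x, of k] B by (intro mult_mono) auto
      finally show ?thesis by simp
    qed
    have bm: "(\<lambda>x. (?A F k x)\<^sup>2) \<in> bounded_measurable N" "(\<lambda>x. (?A G k x)\<^sup>2) \<in> bounded_measurable N"
      using A AG by auto
    have "(\<integral>x. (?A F k x)\<^sup>2 \<partial>N) - (\<integral>x. (?A G k x)\<^sup>2 \<partial>N) = (\<integral>x. (?A F k x)\<^sup>2 - (?A G k x)\<^sup>2 \<partial>N)"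
      using bm integrable_bounded_measurable[OF N] by simp
    also have "\<dots> \<le> (2 * B * e) / real k"
      using bm pt by (intro integral_le_const_bounded[OF N]) auto
    finally show ?thesis using integral_ergodic_average_square_le[OF N S G, of k] by simp
  qed
  then show ?thesis unfolding G_def by (intro exI[of _ "2 * B * e"]) simp
qed

text \<open>Riesz's minimal norm argument: \<open>d\<close> is the infimum of the squared norms,
  midpoints stay above it, and the parallelogram law turns closeness of the norms to
  \<open>d\<close> into closeness of the averages to each other.\<close>

lemma ergodic_average_L2_Cauchy:
  assumes N: "prob_space N" and S: "measure_preserving_map N S" and F: "F \<in> bounded_measurable N"
  obtains d where "(\<lambda>k. \<integral>x. (ergodic_average S F k x)\<^sup>2 \<partial>N) \<longlonglongrightarrow> d"
    and "\<And>k. k \<ge> 1 \<Longrightarrow> d \<le> (\<integral>x. (ergodic_average S F k x)\<^sup>2 \<partial>N)"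
    and "\<And>e. e > 0 \<Longrightarrow> \<exists>K. \<forall>i\<ge>K. \<forall>j\<ge>K.
           (\<integral>x. (ergodic_average S F i x - ergodic_average S F j x)\<^sup>2 \<partial>N) < e"
proof -
  let ?A = "ergodic_average S F"
  define a where "a k = (\<integral>x. (?A k x)\<^sup>2 \<partial>N)" for k
  \<comment> \<open>The length \<open>0\<close> is left out, since that average is zero and would
    force \<open>d = 0\<close>.\<close>
  define d where "d = Inf (a ` {1..})"
  have A: "?A k \<in> bounded_measurable N" for k by (rule bounded_measurable_ergodic_average[OF S F])
  have bdd: "bdd_below (a ` {1..})" by (auto intro!: bdd_belowI[of _ 0] simp: a_def)
  have d: "d \<le> a k" if "k \<ge> 1" for k unfolding d_def using that bdd by (intro cInf_lower) auto
  have mid: "d \<le> (\<integral>x. ((?A m x + ?A n x) / 2)\<^sup>2 \<partial>N)" (is "_ \<le> ?I") if mn: "m \<ge> 1" "n \<ge> 1" for m n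
  proof -
    obtain c where c: "\<And>k. a k \<le> ?I + c / real k"
      using ergodic_average_square_midpoint[OF N S F mn] unfolding a_def by blast
    \<comment> \<open>Every \<open>a k\<close> with \<open>k \<ge> 1\<close> lies between
      \<open>d\<close> and this sequence, whose limit is \<open>?I\<close>.\<close>
    have "(\<lambda>k. ?I + c / real k) \<longlonglongrightarrow> ?I + 0" by (intro tendsto_intros lim_const_over_n)
    then have "d \<le> ?I + 0"
      by (rule tendsto_lowerbound)
         (use c d in \<open>auto intro!: eventually_sequentiallyI[of 1] order_trans[OF d c]\<close>)
    then show ?thesis by simp
  qed
  have lim: "a \<longlonglongrightarrow> d"
  proof (rule LIMSEQ_I)
    fix r :: real assume "r > 0"
    have "\<exists>y\<in>a ` {1..}. y < d + r / 2"
      using bdd \<open>r > 0\<close> unfolding d_def by (subst cInf_less_iff[symmetric]) auto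
    then obtain n where n: "n \<ge> 1" "a n < d + r / 2" by auto
    \<comment> \<open>With equal lengths the midpoint is the average itself, so later norms exceed
      \<open>a n\<close> by at most \<open>c / real k\<close>.\<close>
    obtain c where c: "\<And>k. a k \<le> a n + c / real k"
      using ergodic_average_square_midpoint[OF N S F n(1) n(1)] unfolding a_def by auto
    obtain K where K: "\<And>k. k \<ge> K \<Longrightarrow> \<bar>c / real k\<bar> < r / 2"
      using LIMSEQ_D[OF lim_const_over_n[of c], of "r / 2"] \<open>r > 0\<close> by auto
    show "\<exists>K. \<forall>k\<ge>K. norm (a k - d) < r"
    proof (intro exI[of _ "max 1 K"] allI impI)
      fix k assume "max 1 K \<le> k"
      then have "d \<le> a k" "\<bar>c / real k\<bar> < r / 2" using d K by auto
      then show "norm (a k - d) < r"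
        using c[of k] n(2) unfolding real_norm_def abs_less_iff by linarith
    qed
  qed
  show thesis
  proof (rule that)
    show "(\<lambda>k. \<integral>x. (ergodic_average S F k x)\<^sup>2 \<partial>N) \<longlonglongrightarrow> d"
      using lim by (simp add: a_def[abs_def])
    show "d \<le> (\<integral>x. (ergodic_average S F k x)\<^sup>2 \<partial>N)" if "k \<ge> 1" for k
      using d[OF that] by (simp add: a_def)
    fix e :: real assume "e > 0"
    obtain K where K: "\<And>k. k \<ge> K \<Longrightarrow> \<bar>a k - d\<bar> < e / 4"
      using LIMSEQ_D[OF lim, of "e / 4"] \<open>e > 0\<close> by auto
    show "\<exists>K. \<forall>i\<ge>K. \<forall>j\<ge>K. (\<integral>x. (?A i x - ?A j x)\<^sup>2 \<partial>N) < e"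
    proof (intro exI[of _ "max 1 K"] allI impI)
      fix i j assume ij: "max 1 K \<le> i" "max 1 K \<le> j"
      have bm: "(\<lambda>x. (?A i x)\<^sup>2) \<in> bounded_measurable N" "(\<lambda>x. (?A j x)\<^sup>2) \<in> bounded_measurable N"
        "(\<lambda>x. (1/2 * (?A i x + ?A j x))\<^sup>2) \<in> bounded_measurable N"
        by (intro bounded_measurable_power2 bounded_measurable_mult bounded_measurable_add
            bounded_measurable_const A)+
      \<comment> \<open>The parallelogram law, with the norm of the midpoint bounded below by
        \<open>mid\<close>.\<close>
      have "(\<integral>x. (?A i x - ?A j x)\<^sup>2 \<partial>N) =
         (\<integral>x. 2 * (?A i x)\<^sup>2 + 2 * (?A j x)\<^sup>2 - 4 * (1/2 * (?A i x + ?A j x))\<^sup>2 \<partial>N)"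
        by (intro Bochner_Integration.integral_cong refl) (simp add: power2_eq_square field_simps)
      also have "\<dots> = 2 * a i + 2 * a j - 4 * (\<integral>x. (1/2 * (?A i x + ?A j x))\<^sup>2 \<partial>N)"
        using bm[THEN integrable_bounded_measurable[OF N]] by (simp add: a_def)
      also have "\<dots> \<le> 2 * a i + 2 * a j - 4 * d" using mid[of i j] ij by simp
      also have "\<dots> < e" using K[of i, unfolded abs_less_iff] K[of j, unfolded abs_less_iff] ij by simp
      finally show "(\<integral>x. (?A i x - ?A j x)\<^sup>2 \<partial>N) < e" .
    qed
  qed
qed

section \<open>The invariant sigma-algebra and its conditional expectation\<close>

lemma sets_invariant_algebra:
  assumes S: "S \<in> measurable N N"
  shows "sets (invariant_algebra N S) = {A \<in> sets N. S -` A \<inter> space N = A}"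
proof -
  \<comment> \<open>The strictly invariant sets already form a sigma-algebra, so that generating one
    from them adds no sets; for complements, \<open>S\<close> has to map the space into
    itself.\<close>
  have "sigma_algebra (space N) {A \<in> sets N. S -` A \<inter> space N = A}"
    unfolding sigma_algebra_iff2
  proof (intro conjI ballI allI impI)
    show "{A \<in> sets N. S -` A \<inter> space N = A} \<subseteq> Pow (space N)"
      using sets.sets_into_space by blast
  next
    fix A assume "A \<in> {A \<in> sets N. S -` A \<inter> space N = A}"
    then show "space N - A \<in> {A \<in> sets N. S -` A \<inter> space N = A}"
      using measurable_space[OF S] by auto
  next
    fix A :: "nat \<Rightarrow> 'a set" assume A: "range A \<subseteq> {A \<in> sets N. S -` A \<inter> space N = A}"
    have "S -` (\<Union>i. A i) \<inter> space N = (\<Union>i. S -` A i \<inter> space N)" by blast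
    also have "\<dots> = (\<Union>i. A i)" using A by blast
    finally have "S -` (\<Union>i. A i) \<inter> space N = (\<Union>i. A i)" .
    moreover have "(\<Union>i. A i) \<in> sets N" using A by (intro sets.countable_UN) blast
    ultimately show "(\<Union>i. A i) \<in> {A \<in> sets N. S -` A \<inter> space N = A}" by blast
  qed auto
  then show ?thesis
    unfolding invariant_algebra_def
    by (subst sets_measure_of) (auto dest: sets.sets_into_space simp: sigma_algebra.sigma_sets_eq)
qed

lemma space_invariant_algebra [simp]: "space (invariant_algebra N S) = space N"
  unfolding invariant_algebra_def using sets.space_closed[of N] by (intro space_measure_of) auto

lemma subalgebra_invariant_algebra:
  assumes "S \<in> measurable N N"
  shows "subalgebra N (invariant_algebra N S)"
  unfolding subalgebra_def using sets_invariant_algebra[OF assms] by auto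

text \<open>Invariance is assumed at every point because the sigma-algebra consists of strictly
  invariant sets: the preimages under \<open>P\<close> must be invariant exactly, not just up to
  null sets.\<close>

lemma measurable_invariant_algebra:
  fixes P :: "'a \<Rightarrow> real"
  assumes S: "S \<in> measurable N N" and P: "P \<in> borel_measurable N"
    and inv: "\<And>x. x \<in> space N \<Longrightarrow> P (S x) = P x"
  shows "P \<in> borel_measurable (invariant_algebra N S)"
proof (rule measurableI)
  fix A :: "real set" assume A: "A \<in> sets borel"
  then have "P -` A \<inter> space N \<in> sets N" using P by (rule measurable_sets[rotated])
  moreover have "S -` (P -` A \<inter> space N) \<inter> space N = P -` A \<inter> space N"
    using inv measurable_space[OF S] by auto
  ultimately show "P -` A \<inter> space (invariant_algebra N S) \<in> sets (invariant_algebra N S)"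
    by (simp add: sets_invariant_algebra[OF S])
qed simp

lemma sigma_finite_subalgebra_prob:
  assumes "prob_space N" "subalgebra N C"
  shows "sigma_finite_subalgebra N C"
proof -
  interpret prob_space N by fact
  show ?thesis
    by (intro finite_measure_subalgebra_is_sigma_finite finite_measure_subalgebra.intro
        finite_measure_subalgebra_axioms.intro assms(2)) unfold_locales
qed

lemma invariant_set_funpow:
  assumes S: "measure_preserving_map N S" and A: "S -` A \<inter> space N = A" and x: "x \<in> space N"
  shows "(S ^^ k) x \<in> A \<longleftrightarrow> x \<in> A"
proof (induction k)
  case (Suc k)
  then show ?case using A measure_preserving_funpow_space[OF S x, of k] by auto
qed simp

text \<open>The orbit of \<open>S x\<close> is that of \<open>x\<close> moved by one place.
  Consequently limits of averages are invariant.\<close>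

lemma ergodic_average_comp_diff:
  assumes S: "measure_preserving_map N S" and B: "\<And>x. x \<in> space N \<Longrightarrow> \<bar>F x\<bar> \<le> B"
    and x: "x \<in> space N"
  shows "\<bar>ergodic_average S F k (S x) - ergodic_average S F k x\<bar> \<le> 2 * B / real k"
proof -
  have "\<bar>(\<Sum>j<k. F ((S ^^ (j + 1)) x)) - (\<Sum>j<k. F ((S ^^ j) x))\<bar> \<le> 2 * real 1 * B"
    using B measure_preserving_funpow_space[OF S x] by (intro sum_shift_bound) auto
  moreover have "(S ^^ j) (S x) = (S ^^ (j + 1)) x" for j by (simp add: funpow_swap1)
  ultimately have "\<bar>(\<Sum>j<k. F ((S ^^ j) (S x))) - (\<Sum>j<k. F ((S ^^ j) x))\<bar> / real k \<le> 2 * B / real k"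
    by (intro divide_right_mono) auto
  then show ?thesis
    by (simp add: ergodic_average_def abs_divide flip: diff_divide_distrib)
qed

text \<open>An almost everywhere convergent subsequence of the averages has an invariant limit with
  the same integrals as \<open>F\<close> over invariant sets, which makes it the conditional
  expectation. Only squared norms are recorded, as these become cube integrals; the second part
  holds because the limit of the squared norms is also a lower bound for them.\<close>

theorem mean_ergodic_theorem:
  assumes N: "prob_space N" and S: "measure_preserving_map N S" and F: "F \<in> bounded_measurable N"
  defines "E \<equiv> real_cond_exp N (invariant_algebra N S) F"
  shows "(\<lambda>k. \<integral>x. (ergodic_average S F k x)\<^sup>2 \<partial>N) \<longlonglongrightarrow> (\<integral>x. (E x)\<^sup>2 \<partial>N)"
    and "k \<ge> 1 \<Longrightarrow> (\<integral>x. (E x)\<^sup>2 \<partial>N) \<le> (\<integral>x. (ergodic_average S F k x)\<^sup>2 \<partial>N)"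
proof -
  interpret prob_space N by fact
  let ?A = "ergodic_average S F"
  let ?I = "invariant_algebra N S"
  have Sm: "S \<in> measurable N N" using S by (simp add: measure_preserving_map_def)
  interpret I: sigma_finite_subalgebra N ?I
    by (rule sigma_finite_subalgebra_prob[OF N subalgebra_invariant_algebra[OF Sm]])
  obtain B where B: "B \<ge> 0" "\<And>x. x \<in> space N \<Longrightarrow> \<bar>F x\<bar> \<le> B"
    using F by (rule bounded_measurableE) blast
  have A: "?A k \<in> bounded_measurable N" for k by (rule bounded_measurable_ergodic_average[OF S F])
  note A[THEN bounded_measurable_measurable, measurable]
  have Abd: "\<bar>?A k x\<bar> \<le> B" if "x \<in> space N" for k x
    unfolding ergodic_average_def using B measure_preserving_funpow_space[OF S that]
    by (intro abs_average_le) auto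
  obtain d where lim: "(\<lambda>k. \<integral>x. (?A k x)\<^sup>2 \<partial>N) \<longlonglongrightarrow> d"
    and le: "\<And>k. k \<ge> 1 \<Longrightarrow> d \<le> (\<integral>x. (?A k x)\<^sup>2 \<partial>N)"
    and Cau: "\<And>e. e > 0 \<Longrightarrow> \<exists>K. \<forall>i\<ge>K. \<forall>j\<ge>K. (\<integral>x. (?A i x - ?A j x)\<^sup>2 \<partial>N) < e"
    by (rule ergodic_average_L2_Cauchy[OF N S F]) blast
  have L1: "\<exists>K. \<forall>i\<ge>K. \<forall>j\<ge>K. (\<integral>x. norm (?A i x - ?A j x) \<partial>N) < e" if "e > 0" for e
  proof -
    obtain K where K: "\<forall>i\<ge>K. \<forall>j\<ge>K. (\<integral>x. (?A i x - ?A j x)\<^sup>2 \<partial>N) < e\<^sup>2"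
      using Cau[of "e\<^sup>2"] \<open>e > 0\<close> by auto
    show ?thesis
    proof (intro exI[of _ K] allI impI)
      fix i j assume "K \<le> i" "K \<le> j"
      then have "sqrt (\<integral>x. (?A i x - ?A j x)\<^sup>2 \<partial>N) < e"
        using K \<open>e > 0\<close> by (intro real_less_lsqrt) auto
      then show "(\<integral>x. norm (?A i x - ?A j x) \<partial>N) < e"
        using integral_abs_le_sqrt[OF N bounded_measurable_diff[OF A[of i] A[of j]]] by simp
    qed
  qed
  obtain r where r: "strict_mono r" and AEC: "AE x in N. Cauchy (\<lambda>i. ?A (r i) x)"
    by (rule cauchy_L1_AE_cauchy_subseq[OF integrable_bounded_measurable[OF N A] L1]) auto
  define P where "P x = lim (\<lambda>i. ?A (r i) x)" for x
  have P [measurable]: "P \<in> borel_measurable N" unfolding P_def[abs_def] by measurable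
  have AEP: "AE x in N. (\<lambda>i. ?A (r i) x) \<longlonglongrightarrow> P x"
    using AEC by eventually_elim (simp add: P_def Cauchy_convergent convergent_LIMSEQ_iff[symmetric])
  \<comment> \<open>\<open>lim\<close> depends only on which numbers are limits of the sequence, and
    these are the same at \<open>S x\<close> and at \<open>x\<close>. So \<open>P\<close> is
    invariant at every point, including those where the subsequence diverges.\<close>
  have PS: "P (S x) = P x" if x: "x \<in> space N" for x
  proof -
    have "(\<lambda>i. 2 * B / real (r i)) \<longlonglongrightarrow> 0"
      using LIMSEQ_subseq_LIMSEQ[OF lim_const_over_n[of "2 * B"] r] by (simp add: o_def)
    then have 0: "(\<lambda>i. ?A (r i) (S x) - ?A (r i) x) \<longlonglongrightarrow> 0"
      by (rule Lim_null_comparison[rotated])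
         (use ergodic_average_comp_diff[OF S B(2) x] in \<open>auto intro!: always_eventually\<close>)
    have "(\<lambda>i. ?A (r i) (S x)) \<longlonglongrightarrow> L \<longleftrightarrow> (\<lambda>i. ?A (r i) x) \<longlonglongrightarrow> L" for L
      using tendsto_add[OF 0, of "\<lambda>i. ?A (r i) x" L] tendsto_diff[OF _ 0, of "\<lambda>i. ?A (r i) (S x)" L]
      by auto
    then show ?thesis by (simp add: P_def lim_def)
  qed
  have PI: "P \<in> borel_measurable ?I" using measurable_invariant_algebra[OF Sm P PS] .
  have Pbd: "AE x in N. \<bar>P x\<bar> \<le> B"
    using AEP AE_space
  proof eventually_elim
    case (elim x)
    then have "(\<lambda>i. \<bar>?A (r i) x\<bar>) \<longlonglongrightarrow> \<bar>P x\<bar>" by (intro tendsto_rabs)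
    then show ?case by (rule tendsto_upperbound) (use Abd elim in auto)
  qed
  have Pint: "integrable N P" using Pbd by (intro integrable_const_bound[of _ B]) auto
  have EP: "AE x in N. E x = P x" unfolding E_def
  proof (rule I.real_cond_exp_charact)
    fix C assume "C \<in> sets ?I"
    then have C [measurable]: "C \<in> sets N" and CS: "S -` C \<inter> space N = C"
      by (auto simp: sets_invariant_algebra[OF Sm])
    have CF: "(\<lambda>x. indicator C x * F x) \<in> bounded_measurable N"
      using F by (intro bounded_measurable_mult) (auto simp: bounded_measurable_def indicator_def intro!: exI[of _ 1])
    \<comment> \<open>Invariance of \<open>C\<close> lets the indicator be composed with
      \<open>S ^^ k\<close> as well; the measure is invariant under the whole.\<close>
    have Ck: "(\<integral>x. indicator C x * F ((S ^^ k) x) \<partial>N) = (\<integral>x. indicator C x * F x \<partial>N)" for k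
    proof -
      have "(\<integral>x. indicator C x * F ((S ^^ k) x) \<partial>N) = (\<integral>x. indicator C ((S ^^ k) x) * F ((S ^^ k) x) \<partial>N)"
        using invariant_set_funpow[OF S CS]
        by (intro Bochner_Integration.integral_cong refl) (simp add: indicator_def)
      also have "\<dots> = (\<integral>x. indicator C x * F x \<partial>N)"
        by (rule integral_measure_preserving[OF measure_preserving_funpow[OF S] bounded_measurable_measurable[OF CF]])
      finally show ?thesis .
    qed
    have CFk: "integrable N (\<lambda>x. indicator C x * F ((S ^^ k) x))" for k
      using bounded_measurable_funpow[OF S F]
      by (intro integrable_bounded_measurable[OF N] bounded_measurable_mult)
         (auto simp: bounded_measurable_def indicator_def intro!: exI[of _ 1])
    have CA: "(\<integral>x. indicator C x * ?A k x \<partial>N) = (\<integral>x. indicator C x * F x \<partial>N)" if "k \<ge> 1" for k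
    proof -
      have "(\<integral>x. indicator C x * ?A k x \<partial>N) = (\<integral>x. (1 / real k) * (\<Sum>j<k. indicator C x * F ((S ^^ j) x)) \<partial>N)"
        by (intro Bochner_Integration.integral_cong refl)
          (simp only: ergodic_average_def sum_distrib_left mult_ac)
      also have "\<dots> = (1 / real k) * (\<Sum>j<k. \<integral>x. indicator C x * F ((S ^^ j) x) \<partial>N)"
        unfolding Bochner_Integration.integral_mult_right_zero
        by (subst Bochner_Integration.integral_sum) (rule refl CFk)+
      also have "\<dots> = (\<integral>x. indicator C x * F x \<partial>N)" using that by (simp add: Ck)
      finally show ?thesis .
    qed
    have "(\<lambda>i. \<integral>x. indicator C x * ?A (r i) x \<partial>N) \<longlonglongrightarrow> (\<integral>x. indicator C x * P x \<partial>N)"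
    proof (rule integral_dominated_convergence[where w = "\<lambda>x. B"])
      show "AE x in N. (\<lambda>i. indicator C x * ?A (r i) x) \<longlonglongrightarrow> indicator C x * P x"
        using AEP by eventually_elim (intro tendsto_intros)
      show "AE x in N. norm (indicator C x * ?A (r i) x) \<le> B" for i
        using AE_space by eventually_elim (use Abd B in \<open>auto simp: indicator_def\<close>)
    qed auto
    moreover have "(\<lambda>i. \<integral>x. indicator C x * ?A (r i) x \<partial>N) \<longlonglongrightarrow> (\<integral>x. indicator C x * F x \<partial>N)"
    proof (rule tendsto_eventually, rule eventually_sequentiallyI[of 1])
      fix i :: nat assume "i \<ge> 1"
      then have "r i \<ge> 1" using seq_suble[OF r, of i] by simp
      then show "(\<integral>x. indicator C x * ?A (r i) x \<partial>N) = (\<integral>x. indicator C x * F x \<partial>N)" by (rule CA)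
    qed
    ultimately have "(\<integral>x. indicator C x * F x \<partial>N) = (\<integral>x. indicator C x * P x \<partial>N)"
      using LIMSEQ_unique by blast
    then show "(\<integral>x\<in>C. F x \<partial>N) = (\<integral>x\<in>C. P x \<partial>N)"
      by (simp add: set_lebesgue_integral_def)
  qed (use integrable_bounded_measurable[OF N F] Pint PI in auto)
  \<comment> \<open>Dominated convergence along the subsequence identifies the limit
    \<open>d\<close> found above.\<close>
  have "(\<lambda>i. \<integral>x. (?A (r i) x)\<^sup>2 \<partial>N) \<longlonglongrightarrow> (\<integral>x. (P x)\<^sup>2 \<partial>N)"
  proof (rule integral_dominated_convergence[where w = "\<lambda>x. B\<^sup>2"])
    show "AE x in N. (\<lambda>i. (?A (r i) x)\<^sup>2) \<longlonglongrightarrow> (P x)\<^sup>2"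
      using AEP by eventually_elim (intro tendsto_intros)
    show "AE x in N. norm ((?A (r i) x)\<^sup>2) \<le> B\<^sup>2" for i
      using AE_space by eventually_elim (use Abd B in \<open>simp add: abs_le_square_iff[symmetric]\<close>)
  qed auto
  moreover have "(\<lambda>i. \<integral>x. (?A (r i) x)\<^sup>2 \<partial>N) \<longlonglongrightarrow> d"
    using LIMSEQ_subseq_LIMSEQ[OF lim r] by (simp add: o_def)
  ultimately have "d = (\<integral>x. (P x)\<^sup>2 \<partial>N)" using LIMSEQ_unique by blast
  also have "\<dots> = (\<integral>x. (E x)\<^sup>2 \<partial>N)"
  proof (rule integral_cong_AE)
    show "AE x in N. (P x)\<^sup>2 = (E x)\<^sup>2" using EP by eventually_elim simp
  qed (auto simp: E_def borel_measurable_cond_exp2)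
  finally have d: "d = (\<integral>x. (E x)\<^sup>2 \<partial>N)" .
  show "(\<lambda>k. \<integral>x. (?A k x)\<^sup>2 \<partial>N) \<longlonglongrightarrow> (\<integral>x. (E x)\<^sup>2 \<partial>N)" using lim d by simp
  show "k \<ge> 1 \<Longrightarrow> (\<integral>x. (E x)\<^sup>2 \<partial>N) \<le> (\<integral>x. (?A k x)\<^sup>2 \<partial>N)" using le d by simp
qed

section \<open>Cube measures\<close>

text \<open>An invariant set contains \<open>x\<close> exactly if it contains \<open>S x\<close>, so
  both functions have the same integrals over it. This will give the invariance of the cube
  measures.\<close>

lemma real_cond_exp_invariant_comp:
  assumes N: "prob_space N" and S: "measure_preserving_map N S" and F: "F \<in> bounded_measurable N"
  shows "AE x in N. real_cond_exp N (invariant_algebra N S) (\<lambda>x. F (S x)) x =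
                    real_cond_exp N (invariant_algebra N S) F x"
proof -
  have Sm: "S \<in> measurable N N" using S by (simp add: measure_preserving_map_def)
  interpret I: sigma_finite_subalgebra N "invariant_algebra N S"
    by (rule sigma_finite_subalgebra_prob[OF N subalgebra_invariant_algebra[OF Sm]])
  note Fint = integrable_bounded_measurable[OF N F]
  show ?thesis
  proof (rule I.real_cond_exp_charact)
    fix A assume A: "A \<in> sets (invariant_algebra N S)"
    then have A' [measurable]: "A \<in> sets N" and AS: "S -` A \<inter> space N = A"
      by (auto simp: sets_invariant_algebra[OF Sm])
    have "(\<integral>x. indicator A x * F (S x) \<partial>N) = (\<integral>x. indicator A (S x) * F (S x) \<partial>N)"
      using invariant_set_funpow[OF S AS, of _ 1]
      by (intro Bochner_Integration.integral_cong refl) (simp add: indicator_def)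
    also have "\<dots> = (\<integral>x. indicator A x * F x \<partial>N)"
      using bounded_measurable_measurable[OF F]
      by (intro integral_measure_preserving[OF S, of "\<lambda>x. indicator A x * F x"]) auto
    finally have "(\<integral>x. indicator A x * F (S x) \<partial>N) = (\<integral>x. indicator A x * F x \<partial>N)" .
    then show "(\<integral>x\<in>A. F (S x) \<partial>N) = (\<integral>x\<in>A. real_cond_exp N (invariant_algebra N S) F x \<partial>N)"
      using I.real_cond_exp_intA[OF Fint A] by (simp add: set_lebesgue_integral_def)
  qed (auto intro!: I.real_cond_exp_int(1)[OF Fint] integrable_bounded_measurable[OF N]
      bounded_measurable_comp[OF F Sm])
qed

section \<open>Tensor powers, cube integrals and autocorrelations\<close>

definition cube_prod :: "nat \<Rightarrow> ('a \<Rightarrow> real) \<Rightarrow> (nat \<Rightarrow> 'a) \<Rightarrow> real" where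
  "cube_prod k f x = (\<Prod>j<2 ^ k. f (x j))"

definition cube_integral :: "'a measure \<Rightarrow> ('a \<Rightarrow> 'a) \<Rightarrow> nat \<Rightarrow> ('a \<Rightarrow> real) \<Rightarrow> real" where
  "cube_integral M T k f = (\<integral>x. cube_prod k f x \<partial>cube_measure M T k)"

text \<open>This is \<open>D\<^sub>k(S, f, n)\<close>: the cube measure belongs to \<open>T\<close>,
  the shifts to \<open>S\<close>. It is the squared \<open>L^2\<close> norm of an ergodic average of
  a tensor power, see \<open>cube_autocorrelation_eq\<close>.\<close>

definition cube_autocorrelation ::
  "'a measure \<Rightarrow> ('a \<Rightarrow> 'a) \<Rightarrow> nat \<Rightarrow> ('a \<Rightarrow> 'a) \<Rightarrow> ('a \<Rightarrow> real) \<Rightarrow> nat \<Rightarrow> real" where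
  "cube_autocorrelation M T k S f n =
     (1 / real n)\<^sup>2 * (\<Sum>i<n. \<Sum>j<n. cube_integral M T k (\<lambda>x. f ((S ^^ i) x) * f ((S ^^ j) x)))"

lemma cube_seminorm_eq: "cube_seminorm M T k f = root (2 ^ k) (cube_integral M T k f)"
  by (simp add: cube_seminorm_def cube_integral_def cube_prod_def)

lemma prod_lessThan_double:
  fixes g :: "nat \<Rightarrow> 'b::comm_monoid_mult"
  shows "(\<Prod>j<2 * n. g j) = (\<Prod>j<n. g j) * (\<Prod>j<n. g (n + j))"
proof -
  have "(\<Prod>j<2 * n. g j) = (\<Prod>j\<in>{0..<n}. g j) * (\<Prod>j\<in>{n..<n + n}. g j)"
    by (subst prod.atLeastLessThan_concat) (auto simp: mult_2 atLeast0LessThan)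
  also have "(\<Prod>j\<in>{n..<n + n}. g j) = (\<Prod>j<n. g (n + j))"
    using prod.shift_bounds_nat_ivl[of g 0 n n] by (simp add: atLeast0LessThan add.commute)
  finally show ?thesis by (simp add: atLeast0LessThan)
qed

lemma cube_prod_Suc:
  "cube_prod (Suc k) f x = cube_prod k f (first_half k x) * cube_prod k f (second_half k x)"
  by (simp add: cube_prod_def first_half_def second_half_def prod_lessThan_double)

lemma cube_prod_mult: "cube_prod k (\<lambda>x. f x * g x) x = cube_prod k f x * cube_prod k g x"
  by (simp add: cube_prod_def prod.distrib)

lemma cube_map_funpow:
  "j < 2 ^ k \<Longrightarrow> (cube_map k S ^^ n) x j = (S ^^ n) (x j)"
  by (induction n) (auto simp: cube_map_def)

lemma cube_prod_cube_map_funpow: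
  "cube_prod k f ((cube_map k S ^^ n) x) = cube_prod k (\<lambda>y. f ((S ^^ n) y)) x"
  by (simp add: cube_prod_def cube_map_funpow)

declare cube_measure.simps [simp del]

text \<open>All cube measures in the sequel are those of the one map \<open>T\<close>; other
  transformations are compared with it through commutation.\<close>

locale cube_system = prob_space M for M :: "'a measure" +
  fixes T :: "'a \<Rightarrow> 'a"
  assumes T: "measure_preserving_map M T"
    and cubes: "has_cube_measures M T"
begin

lemma sets_cube_measure [measurable_cong]: "sets (cube_measure M T k) = sets (cube_space M k)"
  by (rule is_relative_square_cube_measure(1)[OF cubes])

lemma relative_square: "is_relative_square M T k (cube_measure M T k) (cube_measure M T (Suc k))"
  by (rule is_relative_square_cube_measure(2)[OF cubes])

lemma space_cube_measure: "space (cube_measure M T k) = {..<2 ^ k} \<rightarrow>\<^sub>E space M"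
  using sets_eq_imp_space_eq[OF sets_cube_measure] by (simp add: cube_space_def space_PiM)

lemma measurable_diagonal: "(\<lambda>x. \<lambda>j\<in>{..<2 ^ 0}. x) \<in> measurable M (cube_space M 0)"
  unfolding cube_space_def by (rule measurable_restrict) simp

lemma prob_space_cube_measure: "prob_space (cube_measure M T k)"
proof (cases k)
  case 0
  then show ?thesis using prob_space_distr[OF measurable_diagonal] by (simp add: cube_measure.simps)
next
  case (Suc k')
  then show ?thesis using relative_square[of k'] by (simp add: is_relative_square_def)
qed

lemma measurable_coordinate: "j < 2 ^ k \<Longrightarrow> (\<lambda>x. x j) \<in> measurable (cube_measure M T k) M"
  unfolding measurable_cong_sets[OF sets_cube_measure refl] cube_space_def
  by (rule measurable_component_singleton) simp

lemma measurable_cube_map: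
  assumes "S \<in> measurable M M"
  shows "cube_map k S \<in> measurable (cube_measure M T k) (cube_measure M T k)"
proof -
  have "(\<lambda>x. \<lambda>j\<in>{..<2 ^ k}. S (x j)) \<in> measurable (cube_measure M T k) (cube_space M k)"
    unfolding cube_space_def
    by (rule measurable_restrict) (use measurable_compose[OF measurable_coordinate assms] in auto)
  then show ?thesis
    unfolding measurable_cong_sets[OF refl sets_cube_measure] cube_map_def[abs_def] .
qed

lemma measurable_first_half:
  "first_half k \<in> measurable (cube_measure M T (Suc k)) (cube_measure M T k)"
proof -
  have "(\<lambda>x. \<lambda>j\<in>{..<2 ^ k}. x j) \<in> measurable (cube_measure M T (Suc k)) (cube_space M k)"
    unfolding cube_space_def
    by (rule measurable_restrict) (auto intro!: measurable_coordinate)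
  then show ?thesis
    unfolding measurable_cong_sets[OF refl sets_cube_measure] first_half_def[abs_def] .
qed

lemma measurable_second_half:
  "second_half k \<in> measurable (cube_measure M T (Suc k)) (cube_measure M T k)"
proof -
  have "(\<lambda>x. \<lambda>j\<in>{..<2 ^ k}. x (2 ^ k + j)) \<in> measurable (cube_measure M T (Suc k)) (cube_space M k)"
    unfolding cube_space_def
    by (rule measurable_restrict) (auto intro!: measurable_coordinate)
  then show ?thesis
    unfolding measurable_cong_sets[OF refl sets_cube_measure] second_half_def[abs_def] .
qed

lemma bounded_measurable_cube_prod:
  assumes "f \<in> bounded_measurable M"
  shows "cube_prod k f \<in> bounded_measurable (cube_measure M T k)"
  unfolding cube_prod_def[abs_def]
  by (intro bounded_measurable_prod bounded_measurable_comp[OF assms measurable_coordinate]) simp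

lemma integral_relative_square:
  assumes "F \<in> bounded_measurable (cube_measure M T k)" "G \<in> bounded_measurable (cube_measure M T k)"
  shows "(\<integral>x. F (first_half k x) * G (second_half k x) \<partial>cube_measure M T (Suc k)) =
     (\<integral>x. real_cond_exp (cube_measure M T k) (invariant_algebra (cube_measure M T k) (cube_map k T)) F x *
          real_cond_exp (cube_measure M T k) (invariant_algebra (cube_measure M T k) (cube_map k T)) G x
        \<partial>cube_measure M T k)"
  using relative_square[of k] assms unfolding is_relative_square_def by blast

text \<open>The image of the next cube measure under the cube map is again a relatively independent
  square, because composing with the cube map does not change conditional expectations on the
  invariant sets. Uniqueness of such squares completes the induction step.\<close>

lemma measure_preserving_cube_map: "measure_preserving_map (cube_measure M T k) (cube_map k T)"
proof (induction k)
  case 0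
  have Tm: "T \<in> measurable M M" "distr M M T = M" using T by (auto simp: measure_preserving_map_def)
  let ?d = "\<lambda>x. \<lambda>j\<in>{..<2 ^ 0}. x"
  have 0: "cube_measure M T 0 = distr M (cube_space M 0) ?d" by (simp add: cube_measure.simps)
  have m0: "cube_map 0 T \<in> measurable (cube_space M 0) (cube_space M 0)"
    using measurable_cube_map[OF Tm(1), of 0]
    by (simp only: measurable_cong_sets[OF sets_cube_measure sets_cube_measure])
  have "distr (cube_measure M T 0) (cube_measure M T 0) (cube_map 0 T) =
      distr (distr M (cube_space M 0) ?d) (cube_space M 0) (cube_map 0 T)"
    by (rule distr_cong[OF 0 sets_cube_measure refl])
  also have "\<dots> = distr M (cube_space M 0) (cube_map 0 T \<circ> ?d)"
    by (rule distr_distr[OF m0 measurable_diagonal])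
  \<comment> \<open>The diagonal embedding intertwines \<open>T\<close> with the cube map of order
    \<open>0\<close>.\<close>
  also have "cube_map 0 T \<circ> ?d = ?d \<circ> T" by (auto simp: cube_map_def fun_eq_iff)
  also have "distr M (cube_space M 0) (?d \<circ> T) = distr (distr M M T) (cube_space M 0) ?d"
    by (rule distr_distr[symmetric, OF measurable_diagonal Tm(1)])
  also have "\<dots> = cube_measure M T 0" by (simp add: Tm(2) 0)
  finally show ?case using measurable_cube_map[OF Tm(1), of 0] by (simp add: measure_preserving_map_def)
next
  case (Suc k)
  let ?N = "cube_measure M T k" and ?N' = "cube_measure M T (Suc k)"
  let ?P = "distr ?N' ?N' (cube_map (Suc k) T)"
  let ?E = "real_cond_exp ?N (invariant_algebra ?N (cube_map k T))"
  have Tm: "T \<in> measurable M M" using T by (auto simp: measure_preserving_map_def)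
  note m = measurable_cube_map[OF Tm]
  note prob = prob_space_cube_measure[of k]
  interpret I: sigma_finite_subalgebra ?N "invariant_algebra ?N (cube_map k T)"
    by (rule sigma_finite_subalgebra_prob[OF prob subalgebra_invariant_algebra[OF m]])
  have halves: "first_half k (cube_map (Suc k) T x) = cube_map k T (first_half k x)"
    "second_half k (cube_map (Suc k) T x) = cube_map k T (second_half k x)" for x
    by (auto simp: first_half_def second_half_def cube_map_def fun_eq_iff)
  have "is_relative_square M T k ?N ?P"
    unfolding is_relative_square_def
  proof (intro conjI ballI)
    show "prob_space ?P" by (rule prob_space.prob_space_distr[OF prob_space_cube_measure m])
    show "sets ?P = sets (cube_space M (Suc k))" by (simp only: sets_distr sets_cube_measure)
    fix F G assume F: "F \<in> bounded_measurable ?N" and G: "G \<in> bounded_measurable ?N"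
    have "(\<lambda>x. F (first_half k x) * G (second_half k x)) \<in> borel_measurable ?N'"
      by (intro bounded_measurable_measurable bounded_measurable_mult
          bounded_measurable_comp[OF F measurable_first_half] bounded_measurable_comp[OF G measurable_second_half])
    then have "(\<integral>x. F (first_half k x) * G (second_half k x) \<partial>?P) =
       (\<integral>x. F (cube_map k T (first_half k x)) * G (cube_map k T (second_half k x)) \<partial>?N')"
      by (subst integral_distr[OF m]) (simp_all only: halves)
    also have "\<dots> = (\<integral>x. ?E (\<lambda>x. F (cube_map k T x)) x * ?E (\<lambda>x. G (cube_map k T x)) x \<partial>?N)"
      by (rule integral_relative_square; rule bounded_measurable_comp[OF _ m]; fact)
    also have "\<dots> = (\<integral>x. ?E F x * ?E G x \<partial>?N)"
    proof (rule integral_cong_AE)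
      show "AE x in ?N. ?E (\<lambda>x. F (cube_map k T x)) x * ?E (\<lambda>x. G (cube_map k T x)) x = ?E F x * ?E G x"
        using real_cond_exp_invariant_comp[OF prob Suc F] real_cond_exp_invariant_comp[OF prob Suc G]
        by eventually_elim simp
    qed (auto intro!: borel_measurable_times borel_measurable_cond_exp2)
    finally show "(\<integral>x. F (first_half k x) * G (second_half k x) \<partial>?P) = (\<integral>x. ?E F x * ?E G x \<partial>?N)" .
  qed
  then have "?P = ?N'" using is_relative_square_unique[OF sets_cube_measure _ relative_square] by blast
  then show ?case using m[of "Suc k"] by (simp only: measure_preserving_map_def)
qed

lemma cube_integral_0: "f \<in> borel_measurable M \<Longrightarrow> cube_integral M T 0 f = (\<integral>x. f x \<partial>M)"
proof -
  assume f: "f \<in> borel_measurable M"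
  have "(\<lambda>x. f (x 0)) \<in> borel_measurable (cube_space M 0)"
    using measurable_compose[OF measurable_coordinate[of 0 0] f]
    by (simp only: measurable_cong_sets[OF sets_cube_measure refl]) simp
  then show ?thesis
    unfolding cube_integral_def cube_prod_def[abs_def] cube_measure.simps
    by (subst integral_distr[OF measurable_diagonal]) (simp_all add: lessThan_Suc)
qed

lemma cube_integral_Suc:
  assumes "f \<in> bounded_measurable M"
  shows "cube_integral M T (Suc k) f = (\<integral>x. (real_cond_exp (cube_measure M T k)
     (invariant_algebra (cube_measure M T k) (cube_map k T)) (cube_prod k f) x)\<^sup>2 \<partial>cube_measure M T k)"
  unfolding cube_integral_def cube_prod_Suc[abs_def] power2_eq_square
  by (rule integral_relative_square) (rule bounded_measurable_cube_prod[OF assms])+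

text \<open>For \<open>k \<ge> 1\<close> a square is integrated; for \<open>k = 0\<close> the value
  is the integral of \<open>f\<close>, which may be negative.\<close>

lemma cube_integral_nonneg:
  assumes "f \<in> bounded_measurable M" "k \<ge> 1"
  shows "0 \<le> cube_integral M T k f"
  using cube_integral_Suc[OF assms(1), of "k - 1"] assms(2) by simp

text \<open>Iterates of the cube map act on a tensor power by shifting \<open>f\<close>, and
  products of tensor powers are tensor powers of products; the rest is expanding the square.\<close>

lemma cube_autocorrelation_eq:
  assumes f: "f \<in> bounded_measurable M" and S: "measure_preserving_map M S"
  shows "(\<integral>x. (ergodic_average (cube_map k S) (cube_prod k f) n x)\<^sup>2 \<partial>cube_measure M T k) =
     cube_autocorrelation M T k S f n"
proof -
  let ?N = "cube_measure M T k"
  let ?c = "\<lambda>i j. cube_prod k (\<lambda>y. f ((S ^^ i) y) * f ((S ^^ j) y))"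
  have int: "integrable ?N (?c i j)" for i j
    by (intro integrable_bounded_measurable[OF prob_space_cube_measure] bounded_measurable_cube_prod
        bounded_measurable_mult bounded_measurable_funpow[OF S f])
  have "(\<integral>x. (ergodic_average (cube_map k S) (cube_prod k f) n x)\<^sup>2 \<partial>?N) =
      (\<integral>x. (1 / real n)\<^sup>2 * (\<Sum>i<n. \<Sum>j<n. ?c i j x) \<partial>?N)"
    by (intro Bochner_Integration.integral_cong refl)
       (simp add: ergodic_average_def cube_prod_cube_map_funpow cube_prod_mult sum_product power2_eq_square)
  also have "\<dots> = (1 / real n)\<^sup>2 * (\<Sum>i<n. \<Sum>j<n. \<integral>x. ?c i j x \<partial>?N)"
    using int by simp
  finally show ?thesis by (simp add: cube_autocorrelation_def cube_integral_def)
qed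

lemma cube_autocorrelation_tendsto:
  assumes f: "f \<in> bounded_measurable M"
  shows "cube_autocorrelation M T k T f \<longlonglongrightarrow> cube_integral M T (Suc k) f"
  using mean_ergodic_theorem(1)[OF prob_space_cube_measure measure_preserving_cube_map
      bounded_measurable_cube_prod[OF f], of k]
  unfolding cube_autocorrelation_eq[OF f T] cube_integral_Suc[OF f, symmetric] .

lemma cube_integral_le_autocorrelation:
  assumes f: "f \<in> bounded_measurable M" and n: "n \<ge> 1"
  shows "cube_integral M T (Suc k) f \<le> cube_autocorrelation M T k T f n"
  using mean_ergodic_theorem(2)[OF prob_space_cube_measure measure_preserving_cube_map
      bounded_measurable_cube_prod[OF f] n, of k]
  unfolding cube_autocorrelation_eq[OF f T] cube_integral_Suc[OF f, symmetric] .

section \<open>Null sets under the cube measures\<close>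

lemma AE_halves:
  assumes P: "AE x in cube_measure M T k. P x"
  shows "AE x in cube_measure M T (Suc k). P (first_half k x)"
    and "AE x in cube_measure M T (Suc k). P (second_half k x)"
proof -
  let ?N = "cube_measure M T k" and ?N' = "cube_measure M T (Suc k)"
  let ?E = "real_cond_exp ?N (invariant_algebra ?N (cube_map k T))"
  interpret N': prob_space ?N' by (rule prob_space_cube_measure)
  have m: "cube_map k T \<in> measurable ?N ?N"
    using measure_preserving_cube_map[of k] by (simp add: measure_preserving_map_def)
  interpret I: sigma_finite_subalgebra ?N "invariant_algebra ?N (cube_map k T)"
    by (rule sigma_finite_subalgebra_prob[OF prob_space_cube_measure subalgebra_invariant_algebra[OF m]])
  obtain A where A: "A \<in> null_sets ?N" "{x \<in> space ?N. \<not> P x} \<subseteq> A"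
    using P by (auto simp: eventually_ae_filter)
  have As [measurable]: "A \<in> sets ?N" using A by auto
  have bmA: "indicator A \<in> bounded_measurable ?N"
    by (auto simp: bounded_measurable_def indicator_def intro!: exI[of _ 1])
  have bm1: "(\<lambda>x. 1) \<in> bounded_measurable ?N" by (rule bounded_measurable_const)
  have "AE x in ?N. ?E (indicator A) x = ?E (\<lambda>x. 0) x"
    using AE_not_in[OF A(1)] by (intro I.real_cond_exp_cong) (auto elim: eventually_mono)
  moreover have "AE x in ?N. ?E (\<lambda>x. 0) x = 0"
    by (rule I.real_cond_exp_F_meas) auto
  ultimately have E0: "AE x in ?N. ?E (indicator A) x = 0" by eventually_elim simp
  have *: "AE x in ?N'. P (h x)" if h: "h \<in> measurable ?N' ?N"
    and 0: "(\<integral>x. indicat_real A (h x) \<partial>?N') = 0" for h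
  proof -
    have "N'.prob (h -` A \<inter> space ?N') = (\<integral>x. indicator (h -` A \<inter> space ?N') x \<partial>?N')"
      using measurable_sets[OF h As] by simp
    also have "\<dots> = (\<integral>x. indicator A (h x) \<partial>?N')"
      by (intro Bochner_Integration.integral_cong) (auto simp: indicator_def)
    finally have "h -` A \<inter> space ?N' \<in> null_sets ?N'"
      using measurable_sets[OF h As] 0 by (simp add: N'.emeasure_eq_measure null_setsI)
    then have "AE x in ?N'. x \<notin> h -` A \<inter> space ?N'" by (rule AE_not_in)
    then show ?thesis using AE_space[of ?N']
    proof eventually_elim
      case (elim x)
      then show ?case using A(2) measurable_space[OF h] by auto
    qed
  qed
  \<comment> \<open>The constant \<open>1\<close> on the other half leaves a product with a
    conditional expectation that vanishes almost everywhere.\<close>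
  have "(\<integral>x. indicator A (first_half k x) \<partial>?N') = (\<integral>x. ?E (indicator A) x * ?E (\<lambda>x. 1) x \<partial>?N)"
    using integral_relative_square[OF bmA bm1] by simp
  also have "\<dots> = 0" using E0 by (intro integral_eq_zero_AE) (auto elim!: eventually_mono)
  finally show "AE x in ?N'. P (first_half k x)" by (rule *[OF measurable_first_half])
  have "(\<integral>x. indicator A (second_half k x) \<partial>?N') = (\<integral>x. ?E (\<lambda>x. 1) x * ?E (indicator A) x \<partial>?N)"
    using integral_relative_square[OF bm1 bmA] by simp
  also have "\<dots> = 0" using E0 by (intro integral_eq_zero_AE) (auto elim!: eventually_mono)
  finally show "AE x in ?N'. P (second_half k x)" by (rule *[OF measurable_second_half])
qed

lemma AE_coordinates:
  assumes P: "AE x in M. P x"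
  shows "AE x in cube_measure M T k. \<forall>j<2 ^ k. P (x j)"
proof (induction k)
  case 0
  obtain A where A: "A \<in> null_sets M" "{x \<in> space M. \<not> P x} \<subseteq> A"
    using P by (auto simp: eventually_ae_filter)
  have "AE x in cube_measure M T 0. x 0 \<notin> A"
  proof -
    have "(\<lambda>x. x 0) -` (space M - A) \<inter> space (cube_space M 0) \<in> sets (cube_space M 0)"
      using measurable_sets[OF measurable_coordinate[of 0 0], of "space M - A"] null_setsD2[OF A(1)]
      by (simp add: sets_cube_measure sets_eq_imp_space_eq[OF sets_cube_measure])
    then have "{x \<in> space (cube_space M 0). x 0 \<notin> A} \<in> sets (cube_space M 0)"
      by (rule back_subst[of "\<lambda>X. X \<in> _"]) (auto simp: cube_space_def space_PiM)
    then show ?thesis using AE_not_in[OF A(1)] unfolding cube_measure.simps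
      by (subst AE_distr_iff[OF measurable_diagonal]) auto
  qed
  then show ?case using AE_space[of "cube_measure M T 0"]
  proof eventually_elim
    case (elim x)
    then have "x 0 \<in> space M" by (auto simp: space_cube_measure)
    with elim A(2) show ?case by auto
  qed
next
  case (Suc k)
  show ?case using AE_halves[OF Suc]
  proof eventually_elim
    case (elim x)
    show ?case
    proof (intro allI impI)
      fix j :: nat assume j: "j < 2 ^ Suc k"
      show "P (x j)"
      proof (cases "j < 2 ^ k")
        case True
        then show ?thesis using elim(1) by (auto simp: first_half_def)
      next
        case False
        with elim(2) j show ?thesis by (auto simp: second_half_def dest!: spec[of _ "j - 2 ^ k"])
      qed
    qed
  qed
qed

text \<open>A null set of \<open>M\<close> stays null in each coordinate of the cube. This makes the
  seminorms well defined on classes modulo null sets and permits truncating essentially bounded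
  functions.\<close>

lemma cube_integral_cong_AE:
  assumes "f \<in> borel_measurable M" "g \<in> borel_measurable M" "AE x in M. f x = g x"
  shows "cube_integral M T k f = cube_integral M T k g"
  unfolding cube_integral_def
proof (rule integral_cong_AE)
  show "AE x in cube_measure M T k. cube_prod k f x = cube_prod k g x"
    using AE_coordinates[OF assms(3), of k] by eventually_elim (auto simp: cube_prod_def)
  show "cube_prod k f \<in> borel_measurable (cube_measure M T k)"
    "cube_prod k g \<in> borel_measurable (cube_measure M T k)"
    unfolding cube_prod_def[abs_def]
    by (intro borel_measurable_prod measurable_compose[OF measurable_coordinate] assms; simp)+
qed

end

lemma commuting_maps_funpow:
  assumes "commuting_maps M S T" "measure_preserving_map M S" "measure_preserving_map M T" "x \<in> space M"
  shows "(S ^^ i) ((T ^^ j) x) = (T ^^ j) ((S ^^ i) x)"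
proof -
  have 1: "S ((T ^^ j) y) = (T ^^ j) (S y)" if "y \<in> space M" for y j
    using that
  proof (induction j)
    case (Suc j)
    then show ?case
      using assms(1) measure_preserving_funpow_space[OF assms(3), of y j] by (simp add: commuting_maps_def)
  qed simp
  show ?thesis
  proof (induction i)
    case (Suc i)
    then show ?case using 1[of "(S ^^ i) x" j] measure_preserving_funpow_space[OF assms(2,4)] by simp
  qed simp
qed

section \<open>Averages along a commuting ergodic map\<close>

lemma sum_swap_pairs:
  "(\<Sum>a\<in>A. \<Sum>b\<in>B. \<Sum>c\<in>C. \<Sum>d\<in>D. X a b c d) = (\<Sum>c\<in>C. \<Sum>d\<in>D. \<Sum>a\<in>A. \<Sum>b\<in>B. X a b c d)"
proof -
  have *: "(\<Sum>a\<in>A. \<Sum>b\<in>B. \<Sum>d\<in>D. Y a b d) = (\<Sum>d\<in>D. \<Sum>a\<in>A. \<Sum>b\<in>B. Y a b d)" for Y D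
  proof -
    have "(\<Sum>a\<in>A. \<Sum>b\<in>B. \<Sum>d\<in>D. Y a b d) = (\<Sum>a\<in>A. \<Sum>d\<in>D. \<Sum>b\<in>B. Y a b d)"
      by (intro sum.cong refl sum.swap)
    also have "\<dots> = (\<Sum>d\<in>D. \<Sum>a\<in>A. \<Sum>b\<in>B. Y a b d)" by (rule sum.swap)
    finally show ?thesis .
  qed
  show ?thesis unfolding *[of "\<lambda>a b c. \<Sum>d\<in>D. X a b c d"] by (intro sum.cong refl *)
qed

text \<open>Invariant sets are null or of full measure, and the constant has the right integral over
  either kind.\<close>

lemma real_cond_exp_ergodic:
  assumes N: "prob_space N" and S: "ergodic_map N S" and F: "F \<in> bounded_measurable N"
  shows "AE x in N. real_cond_exp N (invariant_algebra N S) F x = (\<integral>y. F y \<partial>N)"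
proof -
  interpret prob_space N by fact
  have Sm: "S \<in> measurable N N" using S by (simp add: ergodic_map_def measure_preserving_map_def)
  interpret I: sigma_finite_subalgebra N "invariant_algebra N S"
    by (rule sigma_finite_subalgebra_prob[OF N subalgebra_invariant_algebra[OF Sm]])
  show ?thesis
  proof (rule I.real_cond_exp_charact)
    fix A assume "A \<in> sets (invariant_algebra N S)"
    then have A [measurable]: "A \<in> sets N" and "S -` A \<inter> space N = A"
      by (auto simp: sets_invariant_algebra[OF Sm])
    then have "emeasure N A = 0 \<or> emeasure N A = 1" using S by (auto simp: ergodic_map_def)
    moreover have "AE x in N. x \<notin> A" if "emeasure N A = 0"
      using AE_not_in[of A N] A that by (auto simp: null_sets_def)
    moreover have "AE x in N. x \<in> A" if "emeasure N A = 1"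
      using A that by (intro AE_prob_1) (simp add: emeasure_eq_measure)
    ultimately consider "AE x in N. x \<notin> A" | "AE x in N. x \<in> A" by blast
    then show "(\<integral>x\<in>A. F x \<partial>N) = (\<integral>x\<in>A. (\<integral>y. F y \<partial>N) \<partial>N)"
    proof cases
      case 1
      have 0: "(\<integral>x. indicator A x * G x \<partial>N) = 0" for G :: "_ \<Rightarrow> real"
        using 1 by (intro integral_eq_zero_AE) (auto elim: eventually_mono)
      show ?thesis unfolding set_lebesgue_integral_def real_scaleR_def 0 by (rule refl)
    next
      case 2
      have 1: "(\<integral>x. indicator A x * G x \<partial>N) = (\<integral>x. G x \<partial>N)" if "G \<in> borel_measurable N"
        for G :: "_ \<Rightarrow> real"
        using 2 that by (intro integral_cong_AE) (auto elim: eventually_mono)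
      show ?thesis
        unfolding set_lebesgue_integral_def real_scaleR_def 1[OF bounded_measurable_measurable[OF F]]
          1[OF borel_measurable_const] by (simp add: prob_space)
    qed
  qed (use integrable_bounded_measurable[OF N F] in auto)
qed

lemma ergodic_average_square_tendsto:
  assumes N: "prob_space N" and S: "ergodic_map N S" and F: "F \<in> bounded_measurable N"
  shows "(\<lambda>k. \<integral>x. (ergodic_average S F k x)\<^sup>2 \<partial>N) \<longlonglongrightarrow> (\<integral>x. F x \<partial>N)\<^sup>2"
proof -
  interpret prob_space N by fact
  have "(\<integral>x. (real_cond_exp N (invariant_algebra N S) F x)\<^sup>2 \<partial>N) = (\<integral>x. (\<integral>y. F y \<partial>N)\<^sup>2 \<partial>N)"
  proof (rule integral_cong_AE)
    show "AE x in N. (real_cond_exp N (invariant_algebra N S) F x)\<^sup>2 = (\<integral>y. F y \<partial>N)\<^sup>2"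
      using real_cond_exp_ergodic[OF assms] by eventually_elim simp
  qed (auto intro!: borel_measurable_power borel_measurable_cond_exp2)
  then show ?thesis
    using mean_ergodic_theorem(1)[OF N _ F, of S] S by (simp add: ergodic_map_def prob_space)
qed

context cube_system
begin

lemma cube_integral_cong:
  assumes "f \<in> borel_measurable M" "g \<in> borel_measurable M" "\<And>x. x \<in> space M \<Longrightarrow> f x = g x"
  shows "cube_integral M T k f = cube_integral M T k g"
  using assms by (intro cube_integral_cong_AE) auto

text \<open>The integral of order \<open>k + 1\<close> is a limit of autocorrelations along
  \<open>T\<close>, which are built from integrals of order \<open>k\<close>, and \<open>S\<close>
  can be moved past the iterates of \<open>T\<close>. So the invariance of \<open>M\<close> passes
  to all orders.\<close>

lemma cube_integral_comp:
  assumes S: "measure_preserving_map M S" "commuting_maps M S T" and f: "f \<in> bounded_measurable M"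
  shows "cube_integral M T k (\<lambda>x. f (S x)) = cube_integral M T k f"
  using f
proof (induction k arbitrary: f)
  case 0
  have m: "(\<lambda>x. f (S x)) \<in> borel_measurable M"
    using bounded_measurable_measurable[OF bounded_measurable_funpow[OF S(1) 0, of 1]] by simp
  show ?case
    using integral_measure_preserving[OF S(1) bounded_measurable_measurable[OF 0]]
    by (simp add: cube_integral_0[OF m] cube_integral_0[OF bounded_measurable_measurable[OF 0]])
next
  case (Suc k)
  have fS: "(\<lambda>x. f (S x)) \<in> bounded_measurable M"
    using bounded_measurable_funpow[OF S(1) Suc.prems, of 1] by simp
  have eq: "cube_autocorrelation M T k T (\<lambda>x. f (S x)) n = cube_autocorrelation M T k T f n" for n
  proof -
    have "cube_integral M T k (\<lambda>x. f (S ((T ^^ i) x)) * f (S ((T ^^ j) x))) =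
        cube_integral M T k (\<lambda>x. f ((T ^^ i) x) * f ((T ^^ j) x))" for i j
    proof -
      let ?g = "\<lambda>x. f ((T ^^ i) x) * f ((T ^^ j) x)"
      have g: "?g \<in> bounded_measurable M"
        by (intro bounded_measurable_mult bounded_measurable_funpow[OF T] Suc.prems)
      have "cube_integral M T k (\<lambda>x. f (S ((T ^^ i) x)) * f (S ((T ^^ j) x))) =
          cube_integral M T k (\<lambda>x. ?g (S x))"
      proof (rule cube_integral_cong)
        show "f (S ((T ^^ i) x)) * f (S ((T ^^ j) x)) = ?g (S x)" if "x \<in> space M" for x
          using commuting_maps_funpow[OF S(2,1) T that, of 1] by simp
        show "(\<lambda>x. f (S ((T ^^ i) x)) * f (S ((T ^^ j) x))) \<in> borel_measurable M"
          by (intro bounded_measurable_measurable bounded_measurable_mult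
              bounded_measurable_funpow[OF T fS])
        show "(\<lambda>x. ?g (S x)) \<in> borel_measurable M"
          using bounded_measurable_funpow[OF S(1) g, of 1]
          by (auto dest: bounded_measurable_measurable)
      qed
      also have "\<dots> = cube_integral M T k ?g" by (rule Suc.IH[OF g])
      finally show ?thesis .
    qed
    then show ?thesis by (simp add: cube_autocorrelation_def)
  qed
  show ?case
    using cube_autocorrelation_tendsto[OF fS, of k] cube_autocorrelation_tendsto[OF Suc.prems, of k]
    by (auto simp: eq[abs_def] intro: LIMSEQ_unique)
qed

text \<open>Averaging along the cube map preserves the integral of the tensor power, and a squared
  mean is at most the mean square. In the limit this is monotonicity of the seminorms in the
  order.\<close>

lemma cube_integral_Suc_ge:
  assumes f: "f \<in> bounded_measurable M"
  shows "(cube_integral M T k f)\<^sup>2 \<le> cube_integral M T (Suc k) f"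
proof -
  let ?N = "cube_measure M T k"
  let ?A = "ergodic_average (cube_map k T) (cube_prod k f)"
  have F: "cube_prod k f \<in> bounded_measurable ?N" by (rule bounded_measurable_cube_prod[OF f])
  have A: "?A n \<in> bounded_measurable ?N" for n
    by (rule bounded_measurable_ergodic_average[OF measure_preserving_cube_map F])
  have int: "(\<integral>x. ?A n x \<partial>?N) = cube_integral M T k f" if "n \<ge> 1" for n
  proof -
    have "(\<integral>x. ?A n x \<partial>?N) = (1 / real n) * (\<Sum>i<n. \<integral>x. cube_prod k f ((cube_map k T ^^ i) x) \<partial>?N)"
      unfolding ergodic_average_def
      using integrable_bounded_measurable[OF prob_space_cube_measure
          bounded_measurable_funpow[OF measure_preserving_cube_map F]] by simp
    also have "\<dots> = cube_integral M T k f" using that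
      by (simp add: integral_measure_preserving[OF measure_preserving_funpow[OF measure_preserving_cube_map]
            bounded_measurable_measurable[OF F]] cube_integral_def)
    finally show ?thesis .
  qed
  have "(cube_integral M T k f)\<^sup>2 \<le> cube_autocorrelation M T k T f n" if "n \<ge> 1" for n
    using integral_square_ge[OF prob_space_cube_measure A, of n] int[OF that]
    by (simp add: cube_autocorrelation_eq[OF f T])
  then show ?thesis
    by (intro tendsto_lowerbound[OF cube_autocorrelation_tendsto[OF f]] eventually_sequentiallyI[of 1]) auto
qed

lemma cube_autocorrelation_0:
  assumes f: "f \<in> bounded_measurable M" and S: "measure_preserving_map M S"
  shows "cube_autocorrelation M T 0 S f n = (\<integral>x. (ergodic_average S f n x)\<^sup>2 \<partial>M)"
proof -
  let ?c = "\<lambda>i j x. f ((S ^^ i) x) * f ((S ^^ j) x)"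
  have bm: "?c i j \<in> bounded_measurable M" for i j
    by (intro bounded_measurable_mult bounded_measurable_funpow[OF S f])
  have "(\<integral>x. (ergodic_average S f n x)\<^sup>2 \<partial>M) = (\<integral>x. (1 / real n)\<^sup>2 * (\<Sum>i<n. \<Sum>j<n. ?c i j x) \<partial>M)"
    by (intro Bochner_Integration.integral_cong refl)
       (simp add: ergodic_average_def sum_product power2_eq_square)
  also have "\<dots> = (1 / real n)\<^sup>2 * (\<Sum>i<n. \<Sum>j<n. \<integral>x. ?c i j x \<partial>M)"
    using integrable_bounded_measurable[OF prob_space_axioms bm] by simp
  finally show ?thesis
    by (simp add: cube_autocorrelation_def cube_integral_0[OF bounded_measurable_measurable[OF bm]])
qed

text \<open>Each cube integral of order \<open>k + 1\<close> is bounded by an autocorrelation along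
  \<open>T\<close> of length \<open>n\<close>; exchanging the two double sums then puts the average
  along \<open>S\<close> inside.\<close>

lemma cube_autocorrelation_Suc_le:
  assumes S: "measure_preserving_map M S" "commuting_maps M S T" and f: "f \<in> bounded_measurable M"
    and n: "n \<ge> 1"
  shows "cube_autocorrelation M T (Suc k) S f m \<le>
    (1 / real n)\<^sup>2 * (\<Sum>i<n. \<Sum>j<n.
       cube_autocorrelation M T k S (\<lambda>x. f ((T ^^ i) x) * f ((T ^^ j) x)) m)"
proof -
  let ?g = "\<lambda>i j x. f ((T ^^ i) x) * f ((T ^^ j) x)"
  let ?h = "\<lambda>a b x. f ((S ^^ a) x) * f ((S ^^ b) x)"
  have g: "?g i j \<in> bounded_measurable M" for i j
    by (intro bounded_measurable_mult bounded_measurable_funpow[OF T f])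
  have h: "?h i j \<in> bounded_measurable M" for i j
    by (intro bounded_measurable_mult bounded_measurable_funpow[OF S(1) f])
  \<comment> \<open>Both sides are products of \<open>f\<close> at the images of \<open>x\<close>
    under \<open>S^a T^i\<close>, \<open>S^a T^j\<close>, \<open>S^b T^i\<close> and
    \<open>S^b T^j\<close>, grouped differently.\<close>
  have eq: "cube_integral M T k (\<lambda>x. ?h a b ((T ^^ i) x) * ?h a b ((T ^^ j) x)) =
      cube_integral M T k (\<lambda>x. ?g i j ((S ^^ a) x) * ?g i j ((S ^^ b) x))" for a b i j
  proof (rule cube_integral_cong)
    show "(\<lambda>x. ?h a b ((T ^^ i) x) * ?h a b ((T ^^ j) x)) \<in> borel_measurable M"
      by (intro bounded_measurable_measurable bounded_measurable_mult[of "\<lambda>x. ?h a b ((T ^^ i) x)"]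
          bounded_measurable_funpow[OF T h])
    show "(\<lambda>x. ?g i j ((S ^^ a) x) * ?g i j ((S ^^ b) x)) \<in> borel_measurable M"
      by (intro bounded_measurable_measurable bounded_measurable_mult[of "\<lambda>x. ?g i j ((S ^^ a) x)"]
          bounded_measurable_funpow[OF S(1) g])
    show "?h a b ((T ^^ i) x) * ?h a b ((T ^^ j) x) = ?g i j ((S ^^ a) x) * ?g i j ((S ^^ b) x)"
      if "x \<in> space M" for x
      by (simp add: commuting_maps_funpow[OF S(2,1) T that] mult_ac)
  qed
  have "cube_autocorrelation M T (Suc k) S f m \<le>
     (1 / real m)\<^sup>2 * (\<Sum>a<m. \<Sum>b<m. cube_autocorrelation M T k T (?h a b) n)"
    unfolding cube_autocorrelation_def[of M T "Suc k"]
    by (intro mult_left_mono sum_mono cube_integral_le_autocorrelation[OF h n]) simp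
  also have "\<dots> = (1 / real m)\<^sup>2 * ((1 / real n)\<^sup>2 * (\<Sum>a<m. \<Sum>b<m. \<Sum>i<n. \<Sum>j<n.
      cube_integral M T k (\<lambda>x. ?g i j ((S ^^ a) x) * ?g i j ((S ^^ b) x))))"
    unfolding cube_autocorrelation_def eq sum_distrib_left[symmetric] by (rule refl)
  also have "\<dots> = (1 / real n)\<^sup>2 * ((1 / real m)\<^sup>2 * (\<Sum>i<n. \<Sum>j<n. \<Sum>a<m. \<Sum>b<m.
      cube_integral M T k (\<lambda>x. ?g i j ((S ^^ a) x) * ?g i j ((S ^^ b) x))))"
    by (subst sum_swap_pairs) (simp only: mult.left_commute)
  also have "\<dots> = (1 / real n)\<^sup>2 * (\<Sum>i<n. \<Sum>j<n. cube_autocorrelation M T k S (?g i j) m)"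
    unfolding cube_autocorrelation_def sum_distrib_left[symmetric] by (rule refl)
  finally show ?thesis .
qed

text \<open>Ergodicity of \<open>S\<close> enters at order \<open>0\<close>, where the limit is the
  squared mean of \<open>f\<close>. In the induction step the length \<open>n\<close> along
  \<open>T\<close> is fixed before \<open>m\<close> grows, so that the induction hypothesis is
  applied to finitely many functions.\<close>

theorem cube_autocorrelation_limsup_le:
  assumes S: "ergodic_map M S" "commuting_maps M S T" and f: "f \<in> bounded_measurable M" and "e > 0"
  shows "eventually (\<lambda>m. cube_autocorrelation M T k S f m \<le> cube_integral M T (Suc k) f + e) sequentially"
  using f \<open>e > 0\<close>
proof (induction k arbitrary: f e)
  case (0 f e)
  have S': "measure_preserving_map M S" using S(1) by (simp add: ergodic_map_def)
  have "(\<lambda>m. cube_autocorrelation M T 0 S f m) \<longlonglongrightarrow> (cube_integral M T 0 f)\<^sup>2"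
    using ergodic_average_square_tendsto[OF prob_space_axioms S(1) 0(1)]
    by (simp add: cube_autocorrelation_0[OF 0(1) S'] cube_integral_0[OF bounded_measurable_measurable[OF 0(1)]])
  then have "eventually (\<lambda>m. cube_autocorrelation M T 0 S f m < (cube_integral M T 0 f)\<^sup>2 + e) sequentially"
    by (rule order_tendstoD(2)) (use 0 in simp)
  then show ?case
    using cube_integral_Suc_ge[OF 0(1), of 0] by (auto elim!: eventually_mono)
next
  case (Suc k f e)
  have S': "measure_preserving_map M S" using S(1) by (simp add: ergodic_map_def)
  let ?g = "\<lambda>i j x. f ((T ^^ i) x) * f ((T ^^ j) x)"
  have g: "?g i j \<in> bounded_measurable M" for i j
    by (intro bounded_measurable_mult bounded_measurable_funpow[OF T] Suc.prems)
  have "eventually (\<lambda>n. cube_autocorrelation M T (Suc k) T f n < cube_integral M T (Suc (Suc k)) f + e / 2) sequentially"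
    using cube_autocorrelation_tendsto[OF Suc.prems(1), of "Suc k"] by (rule order_tendstoD(2)) (use Suc in simp)
  then have "eventually (\<lambda>n. n \<ge> 1 \<and> cube_autocorrelation M T (Suc k) T f n < cube_integral M T (Suc (Suc k)) f + e / 2) sequentially"
    using eventually_ge_at_top[of 1] by eventually_elim simp
  then obtain n where n: "n \<ge> 1"
    "cube_autocorrelation M T (Suc k) T f n < cube_integral M T (Suc (Suc k)) f + e / 2"
    using eventually_happens[of _ sequentially] by auto
  have "eventually (\<lambda>m. \<forall>p\<in>{..<n} \<times> {..<n}. cube_autocorrelation M T k S (?g (fst p) (snd p)) m
      \<le> cube_integral M T (Suc k) (?g (fst p) (snd p)) + e / 2) sequentially"
    using Suc.IH[OF g, of "e / 2"] Suc.prems(2) by (intro eventually_ball_finite) auto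
  then show ?case
  proof eventually_elim
    case (elim m)
    have "cube_autocorrelation M T (Suc k) S f m \<le>
       (1 / real n)\<^sup>2 * (\<Sum>i<n. \<Sum>j<n. cube_autocorrelation M T k S (?g i j) m)"
      by (rule cube_autocorrelation_Suc_le[OF S' S(2) Suc.prems(1) n(1)])
    also have "\<dots> \<le> (1 / real n)\<^sup>2 * (\<Sum>i<n. \<Sum>j<n. cube_integral M T (Suc k) (?g i j) + e / 2)"
      using elim by (intro mult_left_mono sum_mono) auto
    also have "\<dots> = cube_autocorrelation M T (Suc k) T f n + e / 2"
    proof -
      have "(\<Sum>i<n. \<Sum>j<n. cube_integral M T (Suc k) (?g i j) + e / 2) =
          (\<Sum>i<n. \<Sum>j<n. cube_integral M T (Suc k) (?g i j)) + (real n)\<^sup>2 * (e / 2)"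
        by (simp add: sum.distrib power2_eq_square)
      then show ?thesis using n(1)
        by (simp add: cube_autocorrelation_def distrib_left power_divide)
    qed
    finally show ?case using n(2) by simp
  qed
qed

end

section \<open>The van der Corput inequality\<close>

text \<open>Replacing \<open>u n\<close> by its mean over \<open>h\<close> consecutive indices
  changes the average by \<open>O(h/m)\<close>; convexity and expanding the square leave the
  correlations of the pairs \<open>i, j < h\<close>. Both shifts are kept, rather than their
  difference, since this is the shape of an autocorrelation; \<open>h\<close> is fixed while
  \<open>m\<close> grows.\<close>

lemma van_der_Corput:
  fixes u :: "nat \<Rightarrow> 'a \<Rightarrow> real"
  assumes N: "prob_space N" and u: "\<And>n. u n \<in> bounded_measurable N"
    and B: "\<And>n x. x \<in> space N \<Longrightarrow> \<bar>u n x\<bar> \<le> B"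
    and h: "h \<ge> 1" and e: "e > 0"
    and corr: "\<And>i j. eventually (\<lambda>m. (1 / real m) * (\<Sum>n<m. \<integral>x. u (n + i) x * u (n + j) x \<partial>N) \<le> c i j) sequentially"
  shows "eventually (\<lambda>m. (\<integral>x. ((1 / real m) * (\<Sum>n<m. u n x))\<^sup>2 \<partial>N)
           \<le> (1 / real h)\<^sup>2 * (\<Sum>i<h. \<Sum>j<h. c i j) + e) sequentially"
proof -
  interpret prob_space N by fact
  obtain x0 where "x0 \<in> space N" using not_empty by blast
  then have B0: "B \<ge> 0" using B[of x0 0] by linarith
  define v where "v m x = (1 / real m) * (\<Sum>n<m. u n x)" for m x
  \<comment> \<open>The smoothed version of \<open>v\<close>, with a window of \<open>h\<close>
    consecutive indices at each \<open>n\<close>.\<close>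
  define w where "w m x = (1 / real m) * (\<Sum>n<m. (1 / real h) * (\<Sum>i<h. u (n + i) x))" for m x
  let ?q = "\<lambda>m x. (1 / real m) * (\<Sum>n<m. (1 / real h)\<^sup>2 * (\<Sum>i<h. \<Sum>j<h. u (n + i) x * u (n + j) x))"
  have vw: "(v m x)\<^sup>2 \<le> ?q m x + 4 * real h * B\<^sup>2 / real m" if x: "x \<in> space N" for m x
  proof -
    have vB: "\<bar>v m x\<bar> \<le> B" unfolding v_def by (rule abs_average_le) (use B x B0 in auto)
    have wB: "\<bar>w m x\<bar> \<le> B" unfolding w_def
      by (intro abs_average_le B0 B x)
    have "w m x = (1 / real h) * (\<Sum>i<h. (1 / real m) * (\<Sum>n<m. u (n + i) x))"
      unfolding w_def sum_distrib_left[symmetric] by (subst sum.swap) simp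
    moreover have "v m x = (1 / real h) * (\<Sum>i<h. v m x)" using h by simp
    ultimately have "w m x - v m x =
        (1 / real h) * (\<Sum>i<h. (1 / real m) * ((\<Sum>n<m. u (n + i) x) - (\<Sum>n<m. u n x)))"
      by (simp add: v_def sum_subtractf right_diff_distrib)
    also have "\<bar>\<dots>\<bar> = \<bar>\<Sum>i<h. (1 / real m) * ((\<Sum>n<m. u (n + i) x) - (\<Sum>n<m. u n x))\<bar> / real h"
      by (simp only: abs_mult abs_divide abs_one abs_of_nat) simp
    also have "\<dots> \<le> (real h * (2 * real h * B / real m)) / real h"
    proof (intro divide_right_mono)
      have "\<bar>(1 / real m) * ((\<Sum>n<m. u (n + i) x) - (\<Sum>n<m. u n x))\<bar> \<le> 2 * real h * B / real m"
        if "i < h" for i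
      proof -
        have "\<bar>(\<Sum>n<m. u (n + i) x) - (\<Sum>n<m. u n x)\<bar> \<le> 2 * real i * B"
          by (rule sum_shift_bound) (use B x in auto)
        also have "\<dots> \<le> 2 * real h * B" using that B0 by (intro mult_right_mono) auto
        finally show ?thesis by (simp add: abs_mult divide_right_mono)
      qed
      then have "(\<Sum>i<h. \<bar>(1 / real m) * ((\<Sum>n<m. u (n + i) x) - (\<Sum>n<m. u n x))\<bar>) \<le>
         real (card {..<h}) * (2 * real h * B / real m)"
        by (intro sum_bounded_above) auto
      then show "\<bar>\<Sum>i<h. (1 / real m) * ((\<Sum>n<m. u (n + i) x) - (\<Sum>n<m. u n x))\<bar>
        \<le> real h * (2 * real h * B / real m)"
        by (intro order_trans[OF sum_abs]) simp
    qed simp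
    also have "\<dots> = 2 * real h * B / real m" using h by simp
    finally have d: "\<bar>w m x - v m x\<bar> \<le> 2 * real h * B / real m" .
    have "(v m x)\<^sup>2 - (w m x)\<^sup>2 \<le> \<bar>v m x + w m x\<bar> * \<bar>w m x - v m x\<bar>"
      by (simp add: abs_mult[symmetric] power2_eq_square algebra_simps abs_le_iff)
    also have "\<dots> \<le> (2 * B) * (2 * real h * B / real m)"
      using vB wB B0 by (intro mult_mono d) auto
    finally have "(v m x)\<^sup>2 \<le> (w m x)\<^sup>2 + 4 * real h * B\<^sup>2 / real m"
      by (simp add: power2_eq_square mult_ac)
    moreover have "(w m x)\<^sup>2 \<le> (1 / real m) * (\<Sum>n<m. ((1 / real h) * (\<Sum>i<h. u (n + i) x))\<^sup>2)"
      unfolding w_def by (rule square_average_le)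
    moreover have "\<dots> = ?q m x"
      by (simp add: power_mult_distrib power2_eq_square sum_product)
    ultimately show ?thesis by linarith
  qed
  have uu: "(\<lambda>x. u a x * u b x) \<in> bounded_measurable N" for a b by (intro bounded_measurable_mult u)
  have qb: "?q m \<in> bounded_measurable N" for m
    by (intro bounded_measurable_mult[of "\<lambda>x. 1 / real m"] bounded_measurable_const bounded_measurable_sum
        bounded_measurable_mult[of "\<lambda>x. (1 / real h)\<^sup>2"] uu)
  have vb: "(\<lambda>x. (v m x)\<^sup>2) \<in> bounded_measurable N" for m unfolding v_def
    by (intro bounded_measurable_power2 bounded_measurable_mult bounded_measurable_const bounded_measurable_sum u)
  have int: "(\<integral>x. (v m x)\<^sup>2 \<partial>N) \<le> (1 / real h)\<^sup>2 * (\<Sum>i<h. \<Sum>j<h.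
      (1 / real m) * (\<Sum>n<m. \<integral>x. u (n + i) x * u (n + j) x \<partial>N)) + 4 * real h * B\<^sup>2 / real m" for m
  proof -
    have "(\<integral>x. (v m x)\<^sup>2 \<partial>N) \<le> (\<integral>x. ?q m x + 4 * real h * B\<^sup>2 / real m \<partial>N)"
      by (intro integral_mono integrable_bounded_measurable[OF N] vb bounded_measurable_add qb
          bounded_measurable_const vw)
    also have "\<dots> = (\<integral>x. ?q m x \<partial>N) + 4 * real h * B\<^sup>2 / real m"
      using integrable_bounded_measurable[OF N qb, of m] by (subst Bochner_Integration.integral_add) (auto simp: prob_space)
    also have "(\<integral>x. ?q m x \<partial>N) = (1 / real m) * (\<Sum>n<m. (1 / real h)\<^sup>2 *
        (\<Sum>i<h. \<Sum>j<h. \<integral>x. u (n + i) x * u (n + j) x \<partial>N))"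
      using integrable_bounded_measurable[OF N uu] by simp
    also have "\<dots> = (1 / real h)\<^sup>2 * (1 / real m * (\<Sum>n<m.
        \<Sum>i<h. \<Sum>j<h. \<integral>x. u (n + i) x * u (n + j) x \<partial>N))"
      unfolding sum_distrib_left[symmetric] by (simp only: mult.left_commute)
    also have "(\<Sum>n<m. \<Sum>i<h. \<Sum>j<h. \<integral>x. u (n + i) x * u (n + j) x \<partial>N) =
        (\<Sum>i<h. \<Sum>j<h. \<Sum>n<m. \<integral>x. u (n + i) x * u (n + j) x \<partial>N)"
      by (subst sum.swap, rule sum.cong[OF refl], rule sum.swap)
    finally show ?thesis unfolding sum_distrib_left .
  qed
  \<comment> \<open>Only finitely many pairs occur, so one threshold for \<open>m\<close> serves
    them all.\<close>
  have "eventually (\<lambda>m. \<forall>p\<in>{..<h} \<times> {..<h}. (1 / real m) * (\<Sum>n<m. \<integral>x. u (n + fst p) x * u (n + snd p) x \<partial>N)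
      \<le> c (fst p) (snd p)) sequentially"
    using corr by (intro eventually_ball_finite) auto
  moreover have "eventually (\<lambda>m. 4 * real h * B\<^sup>2 / real m < e) sequentially"
    using lim_const_over_n[of "4 * real h * B\<^sup>2"] e by (rule order_tendstoD(2))
  ultimately show ?thesis
  proof eventually_elim
    case (elim m)
    have "(1 / real h)\<^sup>2 * (\<Sum>i<h. \<Sum>j<h. (1 / real m) * (\<Sum>n<m. \<integral>x. u (n + i) x * u (n + j) x \<partial>N))
       \<le> (1 / real h)\<^sup>2 * (\<Sum>i<h. \<Sum>j<h. c i j)"
      using elim(1) by (intro mult_left_mono sum_mono) auto
    then show ?case using int[of m] elim(2) unfolding v_def by linarith
  qed
qed

section \<open>Families of commuting transformations\<close>

lemma measure_preserving_space:
  "measure_preserving_map M S \<Longrightarrow> x \<in> space M \<Longrightarrow> S x \<in> space M"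
  by (auto simp: measure_preserving_map_def dest: measurable_space)

lemma invertible_inverse:
  assumes S: "invertible_measure_preserving M S" and x: "x \<in> space M"
  shows "S (inv_into (space M) S x) = x" "inv_into (space M) S (S x) = x"
  using assms by (auto simp: invertible_measure_preserving_def bij_betw_def f_inv_into_f)

lemma invertible_measure_preserving_inverse:
  assumes S: "invertible_measure_preserving M S"
  shows "invertible_measure_preserving M (inv_into (space M) S)" (is "invertible_measure_preserving M ?S'")
proof -
  have Sm: "S \<in> measurable M M" "distr M M S = M" and b: "bij_betw S (space M) (space M)"
    and S'm: "?S' \<in> measurable M M"
    using S by (auto simp: invertible_measure_preserving_def measure_preserving_map_def)
  have "distr M M ?S' = distr (distr M M S) M ?S'" by (simp add: Sm(2))
  also have "\<dots> = distr M M (?S' \<circ> S)" by (rule distr_distr[OF S'm Sm(1)])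
  also have "\<dots> = distr M M (\<lambda>x. x)"
    using invertible_inverse[OF S] by (intro distr_cong) auto
  finally have d: "distr M M ?S' = M" by (simp add: distr_id2)
  have "inv_into (space M) ?S' \<in> measurable M M"
    using Sm(1) by (subst measurable_cong[OF inv_into_inv_into_eq[OF b]]) auto
  then show ?thesis
    using d S'm bij_betw_inv_into[OF b] by (simp add: invertible_measure_preserving_def measure_preserving_map_def)
qed

lemma measure_preserving_comp:
  assumes "measure_preserving_map M R" "measure_preserving_map M S"
  shows "measure_preserving_map M (R \<circ> S)"
  using assms distr_distr[of R M M S M] by (auto simp: measure_preserving_map_def)

lemma inv_into_comp_invertible:
  assumes R: "invertible_measure_preserving M R" and S: "invertible_measure_preserving M S"
    and x: "x \<in> space M"
  shows "inv_into (space M) (R \<circ> S) x = inv_into (space M) S (inv_into (space M) R x)"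
proof -
  have sp: "inv_into (space M) R x \<in> space M" "inv_into (space M) S (inv_into (space M) R x) \<in> space M"
    using invertible_measure_preserving_inverse[OF R] invertible_measure_preserving_inverse[OF S] x
      measure_preserving_space unfolding invertible_measure_preserving_def by metis+
  have "inj_on (R \<circ> S) (space M)"
    using R S by (intro bij_betw_imp_inj_on[OF bij_betw_trans]) (auto simp: invertible_measure_preserving_def)
  then show ?thesis
    using inv_into_f_eq[of "R \<circ> S" "space M" _ x] sp invertible_inverse(1)[OF R x] invertible_inverse(1)[OF S sp(1)]
    by simp
qed

lemma invertible_measure_preserving_comp:
  assumes R: "invertible_measure_preserving M R" and S: "invertible_measure_preserving M S"
  shows "invertible_measure_preserving M (R \<circ> S)"
proof -
  have "(\<lambda>x. inv_into (space M) S (inv_into (space M) R x)) \<in> measurable M M"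
    using R S by (auto simp: invertible_measure_preserving_def intro: measurable_compose)
  then have "inv_into (space M) (R \<circ> S) \<in> measurable M M"
    by (subst measurable_cong[OF inv_into_comp_invertible[OF assms]])
  then show ?thesis
    using R S by (auto simp: invertible_measure_preserving_def intro: measure_preserving_comp bij_betw_trans)
qed

lemma commuting_maps_sym: "commuting_maps M S T \<Longrightarrow> commuting_maps M T S"
  by (simp add: commuting_maps_def)

lemma commuting_maps_inverse:
  assumes S: "invertible_measure_preserving M S" and T: "measure_preserving_map M T"
    and c: "commuting_maps M S T"
  shows "commuting_maps M (inv_into (space M) S) T"
  unfolding commuting_maps_def
proof
  fix x assume x: "x \<in> space M"
  let ?S' = "inv_into (space M) S"
  have sp: "?S' x \<in> space M"
    using invertible_measure_preserving_inverse[OF S] x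
    by (auto simp: invertible_measure_preserving_def intro: measure_preserving_space)
  have "?S' (T x) = ?S' (T (S (?S' x)))" by (simp add: invertible_inverse[OF S x])
  also have "\<dots> = ?S' (S (T (?S' x)))" using c sp by (simp add: commuting_maps_def)
  also have "\<dots> = T (?S' x)" by (rule invertible_inverse(2)[OF S measure_preserving_space[OF T sp]])
  finally show "?S' (T x) = T (?S' x)" .
qed

lemma commuting_maps_comp:
  assumes "commuting_maps M R T" "commuting_maps M S T" "measure_preserving_map M S"
  shows "commuting_maps M (R \<circ> S) T"
  using assms measure_preserving_space[OF assms(3)] by (auto simp: commuting_maps_def)

text \<open>Compositions with \<open>inv_into\<close> can be simplified on the space only, so
  ergodicity has to be insensitive to values outside it.\<close>

lemma ergodic_map_cong:
  assumes "\<And>x. x \<in> space M \<Longrightarrow> S x = S' x" and S: "ergodic_map M S"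
  shows "ergodic_map M S'"
proof -
  have "S' -` A \<inter> space M = S -` A \<inter> space M" for A using assms(1) by auto
  moreover have "S' \<in> measurable M M \<longleftrightarrow> S \<in> measurable M M"
    using assms(1) by (intro measurable_cong) auto
  moreover have "distr M M S' = distr M M S" using assms(1) by (intro distr_cong) auto
  ultimately show ?thesis using S by (simp add: ergodic_map_def measure_preserving_map_def)
qed

text \<open>The index set is arbitrary so that an index can be removed in the induction.\<close>

definition ergodic_family :: "'a measure \<Rightarrow> 'i set \<Rightarrow> ('i \<Rightarrow> 'a \<Rightarrow> 'a) \<Rightarrow> bool" where
  "ergodic_family M J S \<longleftrightarrow>
     (\<forall>j\<in>J. invertible_measure_preserving M (S j) \<and> ergodic_map M (S j)) \<and>
     (\<forall>i\<in>J. \<forall>j\<in>J. commuting_maps M (S i) (S j)) \<and>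
     (\<forall>i\<in>J. \<forall>j\<in>J. i \<noteq> j \<longrightarrow> ergodic_map M (S i \<circ> inv_into (space M) (S j)))"

text \<open>Dividing the quotient of \<open>S i\<close> by \<open>S r\<close> by that of
  \<open>S j\<close> by \<open>S r\<close> gives the quotient of \<open>S i\<close> by
  \<open>S j\<close>, which is ergodic by assumption; the new maps themselves are ergodic as
  quotients within the old family.\<close>

lemma ergodic_family_quotient:
  assumes S: "ergodic_family M J S" and r: "r \<in> J"
  shows "ergodic_family M (J - {r}) (\<lambda>j. S j \<circ> inv_into (space M) (S r))"
proof -
  let ?r = "inv_into (space M) (S r)"
  have inv: "invertible_measure_preserving M (S j)" if "j \<in> J" for j
    using S that by (simp add: ergodic_family_def)
  then have mp: "measure_preserving_map M (S j)" if "j \<in> J" for j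
    using that by (simp add: invertible_measure_preserving_def)
  have com: "commuting_maps M (S i) (S j)" if "i \<in> J" "j \<in> J" for i j
    using S that by (simp add: ergodic_family_def)
  note inv' = invertible_measure_preserving_inverse[OF inv[OF r]]
  then have mp': "measure_preserving_map M ?r" by (simp add: invertible_measure_preserving_def)
  have com1: "commuting_maps M ?r (S j)" if "j \<in> J" for j
    by (intro commuting_maps_inverse inv mp com r that)
  have com2: "commuting_maps M ?r ?r" by (simp add: commuting_maps_def)
  have "commuting_maps M (S i \<circ> ?r) (S j \<circ> ?r)" if "i \<in> J" "j \<in> J" for i j
    using that com com1 com2 mp'
    by (meson commuting_maps_comp commuting_maps_sym)
  moreover have "ergodic_map M ((S i \<circ> ?r) \<circ> inv_into (space M) (S j \<circ> ?r))"
    if "i \<in> J" "j \<in> J" "i \<noteq> j" for i j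
  proof (rule ergodic_map_cong)
    show "ergodic_map M (S i \<circ> inv_into (space M) (S j))"
      using S that by (simp add: ergodic_family_def)
    fix x assume x: "x \<in> space M"
    have sp: "inv_into (space M) (S j) x \<in> space M"
      using invertible_measure_preserving_inverse[OF inv[OF that(2)]] x
      by (auto simp: invertible_measure_preserving_def intro: measure_preserving_space)
    have "inv_into (space M) ?r (inv_into (space M) (S j) x) = S r (inv_into (space M) (S j) x)"
      using inv[OF r] sp by (intro inv_into_inv_into_eq) (auto simp: invertible_measure_preserving_def)
    then show "(S i \<circ> inv_into (space M) (S j)) x = ((S i \<circ> ?r) \<circ> inv_into (space M) (S j \<circ> ?r)) x"
      using inv_into_comp_invertible[OF inv[OF that(2)] inv' x] invertible_inverse(2)[OF inv[OF r] sp]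
      by simp
  qed
  ultimately show ?thesis
    using S r inv inv' by (auto simp: ergodic_family_def intro: invertible_measure_preserving_comp)
qed

text \<open>Commutation makes the powers of a quotient the quotient of the powers. Starting at
  \<open>(R ^^ n) x\<close> avoids powers of the inverse and is the shape needed for a change of
  variables.\<close>

lemma funpow_quotient:
  assumes R: "invertible_measure_preserving M R" and S: "measure_preserving_map M S"
    and c: "commuting_maps M S R" and x: "x \<in> space M"
  shows "((S \<circ> inv_into (space M) R) ^^ n) ((R ^^ n) x) = (S ^^ n) x"
  using x
proof (induction n arbitrary: x)
  case (Suc n)
  have mpR: "measure_preserving_map M R" using R by (simp add: invertible_measure_preserving_def)
  have "((S \<circ> inv_into (space M) R) ^^ Suc n) ((R ^^ Suc n) x) =
      S (inv_into (space M) R (((S \<circ> inv_into (space M) R) ^^ n) ((R ^^ n) (R x))))"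
    by (subst funpow_Suc_right[of n R]) simp
  also have "\<dots> = S (inv_into (space M) R ((S ^^ n) (R x)))"
    by (simp only: Suc.IH[OF measure_preserving_space[OF mpR Suc.prems]])
  also have "(S ^^ n) (R x) = R ((S ^^ n) x)"
    using commuting_maps_funpow[OF c S mpR Suc.prems, of n 1] by simp
  also have "inv_into (space M) R (R ((S ^^ n) x)) = (S ^^ n) x"
    by (rule invertible_inverse(2)[OF R measure_preserving_funpow_space[OF S Suc.prems]])
  finally show ?case by simp
qed simp

section \<open>Multiple averages\<close>

text \<open>Concavity of the root, obtained from convexity of the even power. In the application
  \<open>n\<close> is a power of two and the average is over pairs of shifts.\<close>

lemma root_average_le:
  fixes a :: "'b \<Rightarrow> real"
  assumes A: "finite A" "A \<noteq> {}" and a: "\<And>x. x \<in> A \<Longrightarrow> 0 \<le> a x" and n: "n > 0" "even n"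
  shows "(\<Sum>x\<in>A. root n (a x)) / real (card A) \<le> root n ((\<Sum>x\<in>A. a x) / real (card A))"
proof -
  have c: "real (card A) > 0" using A by (simp add: card_gt_0_iff)
  have "(\<Sum>x\<in>A. (1 / real (card A)) *\<^sub>R root n (a x)) ^ n \<le> (\<Sum>x\<in>A. (1 / real (card A)) * root n (a x) ^ n)"
    using A c a by (intro convex_on_sum[OF _ _ convex_power_even[OF n(2)]]) auto
  then have "((\<Sum>x\<in>A. root n (a x)) / real (card A)) ^ n \<le> (\<Sum>x\<in>A. a x) / real (card A)"
    using a n by (simp add: sum_divide_distrib)
  then have "root n (((\<Sum>x\<in>A. root n (a x)) / real (card A)) ^ n) \<le> root n ((\<Sum>x\<in>A. a x) / real (card A))"
    using n by simp
  moreover have "0 \<le> (\<Sum>x\<in>A. root n (a x)) / real (card A)"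
    using a n(1) by (intro divide_nonneg_nonneg sum_nonneg real_root_ge_zero) auto
  ultimately show ?thesis using n by (simp add: real_root_power_cancel)
qed

text \<open>Continuity of the root: an error under the root is traded for one outside it.\<close>

lemma root_le_add:
  fixes C :: real
  assumes "d > 0" "n > 0"
  obtains e where "e > 0" "root n (C + e) \<le> root n C + d"
proof -
  have "((\<lambda>e. root n (C + e)) \<longlongrightarrow> root n (C + 0)) (at_right 0)"
    by (intro tendsto_intros)
  then have "eventually (\<lambda>e. root n (C + e) < root n C + d) (at_right 0)"
    by (rule order_tendstoD(2)) (use assms in simp)
  then have "eventually (\<lambda>e. root n (C + e) < root n C + d \<and> 0 < e) (at_right (0::real))"
    using eventually_at_right_less[of 0] by eventually_elim simp
  then obtain e where "root n (C + e) < root n C + d" "0 < e"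
    using eventually_happens[of _ "at_right (0::real)"] by auto
  then show thesis by (intro that[of e]) auto
qed

text \<open>\<open>multiple_average\<close> over an arbitrary index set, as the removal of an index
  in the induction requires.\<close>

definition multi_average ::
  "'i set \<Rightarrow> ('i \<Rightarrow> 'a \<Rightarrow> 'a) \<Rightarrow> ('i \<Rightarrow> 'a \<Rightarrow> real) \<Rightarrow> nat \<Rightarrow> 'a \<Rightarrow> real" where
  "multi_average J S f N x = (1 / real N) * (\<Sum>n<N. \<Prod>j\<in>J. f j ((S j ^^ n) x))"

context cube_system
begin

lemma bounded_measurable_multi_average:
  assumes "\<And>j. j \<in> J \<Longrightarrow> measure_preserving_map M (S j)" "\<And>j. j \<in> J \<Longrightarrow> f j \<in> bounded_measurable M"
  shows "multi_average J S f N \<in> bounded_measurable M"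
proof -
  have "(\<lambda>x. (1 / real N) * (\<Sum>n<N. \<Prod>j\<in>J. f j ((S j ^^ n) x))) \<in> bounded_measurable M"
    by (intro bounded_measurable_mult bounded_measurable_const bounded_measurable_sum
        bounded_measurable_prod bounded_measurable_funpow assms)
  then show ?thesis by (simp add: multi_average_def[abs_def])
qed

lemma integral_mult_le_L2_norm:
  assumes "F \<in> bounded_measurable M" "G \<in> bounded_measurable M" "\<And>x. x \<in> space M \<Longrightarrow> \<bar>F x\<bar> \<le> c" "0 \<le> c"
  shows "(\<integral>x. F x * G x \<partial>M) \<le> c * L2_norm M G"
proof -
  have "(\<lambda>x. \<bar>G x\<bar>) \<in> bounded_measurable M" using assms(2) by (auto simp: bounded_measurable_def)
  note int = integrable_bounded_measurable[OF prob_space_axioms this]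
    integrable_bounded_measurable[OF prob_space_axioms bounded_measurable_mult[OF assms(1,2)]]
  have "(\<integral>x. F x * G x \<partial>M) \<le> (\<integral>x. c * \<bar>G x\<bar> \<partial>M)"
  proof (rule integral_mono)
    fix x assume x: "x \<in> space M"
    have "F x * G x \<le> \<bar>F x\<bar> * \<bar>G x\<bar>" by (simp add: abs_mult[symmetric])
    also have "\<dots> \<le> c * \<bar>G x\<bar>" by (intro mult_right_mono assms(3) x) auto
    finally show "F x * G x \<le> c * \<bar>G x\<bar>" .
  qed (use int in auto)
  also have "\<dots> = c * (\<integral>x. \<bar>G x\<bar> \<partial>M)" by simp
  also have "\<dots> \<le> c * L2_norm M G"
    unfolding L2_norm_def by (intro mult_left_mono integral_abs_le_sqrt prob_space_axioms assms)
  finally show ?thesis .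
qed

text \<open>The integrand on the left is a function of \<open>(S r ^^ n) x\<close>. Substituting for
  this point removes \<open>n\<close> from the factor of index \<open>r\<close> and turns the other
  maps into quotients by \<open>S r\<close>.\<close>

lemma integral_shifted_product:
  fixes a b :: nat
  assumes J: "finite J" "r \<in> J" and S: "ergodic_family M J S"
    and f: "\<And>j. j \<in> J \<Longrightarrow> f j \<in> bounded_measurable M"
  defines "g \<equiv> \<lambda>j x. f j ((S j ^^ a) x) * f j ((S j ^^ b) x)"
  shows "(\<integral>x. (\<Prod>j\<in>J. f j ((S j ^^ (n + a)) x)) * (\<Prod>j\<in>J. f j ((S j ^^ (n + b)) x)) \<partial>M) =
    (\<integral>x. g r x * (\<Prod>j\<in>J - {r}. g j (((S j \<circ> inv_into (space M) (S r)) ^^ n) x)) \<partial>M)"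
proof -
  let ?R = "\<lambda>j. S j \<circ> inv_into (space M) (S r)"
  have inv: "invertible_measure_preserving M (S j)" if "j \<in> J" for j
    using S that by (simp add: ergodic_family_def)
  then have mp: "measure_preserving_map M (S j)" if "j \<in> J" for j
    using that by (simp add: invertible_measure_preserving_def)
  have mpR: "measure_preserving_map M (?R j)" if "j \<in> J - {r}" for j
    using ergodic_family_quotient[OF S J(2)] that by (simp add: ergodic_family_def ergodic_map_def)
  have g: "g j \<in> bounded_measurable M" if "j \<in> J" for j unfolding g_def
    by (intro bounded_measurable_mult bounded_measurable_funpow mp f that)
  define G where "G x = g r x * (\<Prod>j\<in>J - {r}. g j ((?R j ^^ n) x))" for x
  have G: "G \<in> bounded_measurable M" unfolding G_def
    by (intro bounded_measurable_mult g J bounded_measurable_prod bounded_measurable_funpow mpR) auto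
  have "(\<Prod>j\<in>J. f j ((S j ^^ (n + a)) x)) * (\<Prod>j\<in>J. f j ((S j ^^ (n + b)) x)) = G ((S r ^^ n) x)"
    if x: "x \<in> space M" for x
  proof -
    have "(S j ^^ (n + c)) x = (S j ^^ c) ((S j ^^ n) x)" for j c
      by (subst add.commute) (simp add: funpow_add)
    then have "(\<Prod>j\<in>J. f j ((S j ^^ (n + a)) x)) * (\<Prod>j\<in>J. f j ((S j ^^ (n + b)) x)) =
        (\<Prod>j\<in>J. g j ((S j ^^ n) x))"
      by (simp add: g_def prod.distrib)
    also have "\<dots> = g r ((S r ^^ n) x) * (\<Prod>j\<in>J - {r}. g j ((S j ^^ n) x))"
      by (rule prod.remove[OF J])
    also have "(\<Prod>j\<in>J - {r}. g j ((S j ^^ n) x)) = (\<Prod>j\<in>J - {r}. g j ((?R j ^^ n) ((S r ^^ n) x)))"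
      using S J(2) by (intro prod.cong refl arg_cong[of _ _ "g _"] funpow_quotient[symmetric] inv mp x)
        (auto simp: ergodic_family_def)
    finally show ?thesis by (simp add: G_def)
  qed
  then have "(\<integral>x. (\<Prod>j\<in>J. f j ((S j ^^ (n + a)) x)) * (\<Prod>j\<in>J. f j ((S j ^^ (n + b)) x)) \<partial>M) =
      (\<integral>x. G ((S r ^^ n) x) \<partial>M)"
    by (intro Bochner_Integration.integral_cong refl)
  also have "\<dots> = (\<integral>x. G x \<partial>M)"
    by (rule integral_measure_preserving[OF measure_preserving_funpow[OF mp[OF J(2)]]
          bounded_measurable_measurable[OF G]])
  finally show ?thesis by (simp add: G_def)
qed

text \<open>The factor \<open>g r\<close> is free of \<open>n\<close> and bounded by
  \<open>c\<^sup>2\<close>, so it comes out of the average over \<open>n\<close>; what remains is a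
  multiple average with one map fewer.\<close>

lemma average_correlation_le:
  fixes a b :: nat
  assumes J: "finite J" "r \<in> J" and S: "ergodic_family M J S"
    and f: "\<And>j. j \<in> J \<Longrightarrow> f j \<in> bounded_measurable M"
    and c: "\<And>x. x \<in> space M \<Longrightarrow> \<bar>f r x\<bar> \<le> c" "0 \<le> c"
  defines "g \<equiv> \<lambda>j x. f j ((S j ^^ a) x) * f j ((S j ^^ b) x)"
  shows "(1 / real m) * (\<Sum>n<m. \<integral>x. (\<Prod>j\<in>J. f j ((S j ^^ (n + a)) x)) * (\<Prod>j\<in>J. f j ((S j ^^ (n + b)) x)) \<partial>M)
    \<le> c\<^sup>2 * L2_norm M (multi_average (J - {r}) (\<lambda>j. S j \<circ> inv_into (space M) (S r)) g m)"
proof -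
  let ?R = "\<lambda>j. S j \<circ> inv_into (space M) (S r)"
  have mp: "measure_preserving_map M (S j)" if "j \<in> J" for j
    using S that by (simp add: ergodic_family_def ergodic_map_def)
  have mpR: "measure_preserving_map M (?R j)" if "j \<in> J - {r}" for j
    using ergodic_family_quotient[OF S J(2)] that by (simp add: ergodic_family_def ergodic_map_def)
  have g: "g j \<in> bounded_measurable M" if "j \<in> J" for j unfolding g_def
    by (intro bounded_measurable_mult bounded_measurable_funpow mp f that)
  let ?p = "\<lambda>n x. g r x * (\<Prod>j\<in>J - {r}. g j ((?R j ^^ n) x))"
  have p: "?p n \<in> bounded_measurable M" for n
    by (intro bounded_measurable_mult g J bounded_measurable_prod bounded_measurable_funpow mpR) auto
  have "(1 / real m) * (\<Sum>n<m. \<integral>x. (\<Prod>j\<in>J. f j ((S j ^^ (n + a)) x)) * (\<Prod>j\<in>J. f j ((S j ^^ (n + b)) x)) \<partial>M)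
     = (1 / real m) * (\<Sum>n<m. \<integral>x. ?p n x \<partial>M)"
    unfolding g_def by (simp only: integral_shifted_product[OF J S f])
  also have "\<dots> = (\<integral>x. (1 / real m) * (\<Sum>n<m. ?p n x) \<partial>M)"
    unfolding Bochner_Integration.integral_mult_right_zero
    by (subst Bochner_Integration.integral_sum)
       (rule integrable_bounded_measurable[OF prob_space_axioms p] refl)+
  also have "\<dots> = (\<integral>x. g r x * multi_average (J - {r}) ?R g m x \<partial>M)"
    by (simp only: multi_average_def sum_distrib_left mult.left_commute)
  also have "\<dots> \<le> c\<^sup>2 * L2_norm M (multi_average (J - {r}) ?R g m)"
  proof (rule integral_mult_le_L2_norm)
    fix x assume x: "x \<in> space M"
    have "\<bar>f r ((S r ^^ a) x)\<bar> \<le> c" "\<bar>f r ((S r ^^ b) x)\<bar> \<le> c"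
      using c measure_preserving_funpow_space[OF mp[OF J(2)] x] by auto
    then show "\<bar>g r x\<bar> \<le> c\<^sup>2"
      unfolding g_def abs_mult power2_eq_square using c(2) by (intro mult_mono) auto
  qed (auto intro!: g J bounded_measurable_multi_average mpR)
  finally show ?thesis .
qed

text \<open>The bounds \<open>c j\<close> are carried along because the products formed in the
  induction step are bounded by their squares. The order grows by one with each map: concavity of
  the root and the autocorrelation bound turn the averaged seminorms of order \<open>l + 1\<close>
  into the square of the seminorm of order \<open>l + 2\<close>.\<close>

theorem multi_average_bound:
  assumes "finite J" "card J = Suc l" "i \<in> J" "ergodic_family M J S"
    and "\<And>j. j \<in> J \<Longrightarrow> commuting_maps M (S j) T"
    and "\<And>j. j \<in> J \<Longrightarrow> f j \<in> bounded_measurable M"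
    and "\<And>j x. j \<in> J \<Longrightarrow> x \<in> space M \<Longrightarrow> \<bar>f j x\<bar> \<le> c j" "\<And>j. j \<in> J \<Longrightarrow> 0 \<le> c j"
    and "e > 0"
  shows "eventually (\<lambda>N. L2_norm M (multi_average J S f N) \<le>
           cube_seminorm M T (Suc l) (f i) * (\<Prod>j\<in>J - {i}. c j) + e) sequentially"
  using assms
proof (induction l arbitrary: J i S f c e)
  case (0 J i S f c e)
  then have J: "J = {i}" by (auto simp: card_1_singleton_iff)
  have avg: "multi_average J S f N = ergodic_average (S i) (f i) N" for N
    by (auto simp: multi_average_def ergodic_average_def J fun_eq_iff)
  have S: "measure_preserving_map M (S i)" "ergodic_map M (S i)"
    using 0(3,4) by (auto simp: ergodic_family_def ergodic_map_def)
  note fi = 0(6)[OF 0(3)]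
  \<comment> \<open>The error \<open>e\<^sup>2\<close> becomes \<open>e\<close> after the square
    root.\<close>
  have "eventually (\<lambda>m. cube_autocorrelation M T 0 (S i) (f i) m \<le> cube_integral M T (Suc 0) (f i) + e\<^sup>2) sequentially"
    using cube_autocorrelation_limsup_le[OF S(2) 0(5)[OF 0(3)] fi] 0(9) by simp
  then show ?case
  proof eventually_elim
    case (elim m)
    have "L2_norm M (multi_average J S f m) = sqrt (cube_autocorrelation M T 0 (S i) (f i) m)"
      by (simp add: L2_norm_def avg cube_autocorrelation_0[OF fi S(1)])
    also have "\<dots> \<le> sqrt (cube_integral M T (Suc 0) (f i) + e\<^sup>2)" using elim by simp
    also have "\<dots> \<le> sqrt (cube_integral M T (Suc 0) (f i)) + sqrt (e\<^sup>2)"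
      using cube_integral_nonneg[OF fi, of "Suc 0"] by (intro sqrt_add_le_add_sqrt) auto
    finally show ?case using 0(9) by (simp add: J cube_seminorm_eq sqrt_def[symmetric])
  qed
next
  case (Suc l J i S f c e)
  obtain r where r: "r \<in> J" "r \<noteq> i"
  proof -
    have "J - {i} \<noteq> {}" using Suc.prems(2,3) by (metis card_1_singleton_iff card_Diff_singleton card.empty diff_Suc_1 nat.simps(3))
    then show thesis using that by blast
  qed
  let ?R = "\<lambda>j. S j \<circ> inv_into (space M) (S r)"
  let ?g = "\<lambda>a b j x. f j ((S j ^^ a) x) * f j ((S j ^^ b) x)"
  \<comment> \<open>The seminorm of order \<open>l + 1\<close>, spelled out as a root for the sake
    of \<open>root_average_le\<close>.\<close>
  define q where "q h = root (2 ^ Suc l) (cube_integral M T (Suc l) h)" for h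
  \<comment> \<open>Arises as \<open>(c r)\<^sup>2\<close>, from the factor pulled out of the
    average, times \<open>(c j)\<^sup>2\<close> for the indices other than \<open>r\<close> and
    \<open>i\<close>.\<close>
  define K where "K = (\<Prod>j\<in>J - {i}. c j)\<^sup>2"
  have K0: "K \<ge> 0" by (simp add: K_def)
  have inv: "invertible_measure_preserving M (S j)" if "j \<in> J" for j
    using Suc.prems(4) that by (simp add: ergodic_family_def)
  then have mp: "measure_preserving_map M (S j)" if "j \<in> J" for j
    using that by (simp add: invertible_measure_preserving_def)
  have comR: "commuting_maps M (?R j) T" if "j \<in> J" for j
    using that r invertible_measure_preserving_inverse[OF inv[OF r(1)]]
    by (intro commuting_maps_comp commuting_maps_inverse inv T Suc.prems(5))
       (auto simp: invertible_measure_preserving_def)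
  have fS: "(\<lambda>x. f j ((S j ^^ a) x)) \<in> bounded_measurable M" if "j \<in> J" for j a
    by (intro bounded_measurable_funpow mp Suc.prems(6) that)
  have g: "?g a b j \<in> bounded_measurable M" if "j \<in> J" for a b j
    by (intro bounded_measurable_mult fS that)
  have gB: "\<bar>?g a b j x\<bar> \<le> (c j)\<^sup>2" if "j \<in> J" "x \<in> space M" for a b j x
    unfolding power2_eq_square abs_mult
    using Suc.prems(8)[OF that(1)] Suc.prems(7)[OF that(1)] measure_preserving_funpow_space[OF mp[OF that(1)] that(2)]
    by (intro mult_mono) auto
  \<comment> \<open>Error budget: \<open>K * D\<close> from the root, \<open>D\<close> from the
    correlations and \<open>D\<close> from the van der Corput inequality, \<open>e\<^sup>2\<close>
    in total.\<close>
  define D where "D = e\<^sup>2 / (K + 2)"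
  have D: "D > 0" using K0 Suc.prems(9) by (simp add: D_def)
  have corr: "eventually (\<lambda>m. (1 / real m) * (\<Sum>n<m. \<integral>x. (\<Prod>j\<in>J. f j ((S j ^^ (n + a)) x)) *
      (\<Prod>j\<in>J. f j ((S j ^^ (n + b)) x)) \<partial>M) \<le> K * q (?g a b i) + D) sequentially" for a b
  proof -
    \<comment> \<open>Adding \<open>1\<close> keeps the denominator positive when
      \<open>c r = 0\<close>.\<close>
    define d where "d = D / ((c r)\<^sup>2 + 1)"
    have "(c r)\<^sup>2 + 1 > 0" by (simp add: add_nonneg_pos)
    then have d: "d > 0" "(c r)\<^sup>2 * d \<le> D" using D by (auto simp: d_def field_simps)
    have "eventually (\<lambda>N. L2_norm M (multi_average (J - {r}) ?R (?g a b) N) \<le>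
        cube_seminorm M T (Suc l) (?g a b i) * (\<Prod>j\<in>J - {r} - {i}. (c j)\<^sup>2) + d) sequentially"
      using Suc.prems r d gB
      by (intro Suc.IH ergodic_family_quotient comR g) auto
    then show ?thesis
    proof eventually_elim
      case (elim m)
      have "(1 / real m) * (\<Sum>n<m. \<integral>x. (\<Prod>j\<in>J. f j ((S j ^^ (n + a)) x)) *
          (\<Prod>j\<in>J. f j ((S j ^^ (n + b)) x)) \<partial>M)
         \<le> (c r)\<^sup>2 * L2_norm M (multi_average (J - {r}) ?R (?g a b) m)"
        using Suc.prems r by (intro average_correlation_le) auto
      also have "\<dots> \<le> (c r)\<^sup>2 * (q (?g a b i) * (\<Prod>j\<in>J - {r} - {i}. (c j)\<^sup>2) + d)"
        using elim by (intro mult_left_mono) (auto simp: cube_seminorm_eq q_def)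
      also have "\<dots> = ((c r)\<^sup>2 * (\<Prod>j\<in>J - {r} - {i}. (c j)\<^sup>2)) * q (?g a b i) + (c r)\<^sup>2 * d"
        by (simp add: algebra_simps)
      also have "(c r)\<^sup>2 * (\<Prod>j\<in>J - {r} - {i}. (c j)\<^sup>2) = K"
        using prod.remove[of "J - {i}" r "\<lambda>j. (c j)\<^sup>2"] Suc.prems(1) r
        by (simp add: K_def prod_power_distrib Diff_insert2[symmetric] insert_commute)
      finally show ?case using d(2) by simp
    qed
  qed
  have q0: "cube_integral M T (Suc l) (?g a b i) \<ge> 0" for a b
    by (intro cube_integral_nonneg g Suc.prems) simp
  let ?C = "cube_integral M T (Suc (Suc l)) (f i)"
  have C0: "?C \<ge> 0" by (intro cube_integral_nonneg Suc.prems) auto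
  obtain t where t: "t > 0" "root (2 ^ Suc l) (?C + t) \<le> root (2 ^ Suc l) ?C + D"
    using root_le_add[OF D, of "2 ^ Suc l"] by auto
  have "ergodic_map M (S i)" using Suc.prems(3,4) by (simp add: ergodic_family_def)
  from cube_autocorrelation_limsup_le[OF this Suc.prems(5)[OF Suc.prems(3)] Suc.prems(6)[OF Suc.prems(3)] t(1), of "Suc l"]
  have "eventually (\<lambda>h. h \<ge> 1 \<and> cube_autocorrelation M T (Suc l) (S i) (f i) h \<le> ?C + t) sequentially"
    using eventually_ge_at_top[of 1] by eventually_elim simp
  \<comment> \<open>The number \<open>h\<close> of shifts is fixed here, before the length of the
    averages tends to infinity.\<close>
  then obtain h where h: "h \<ge> 1" "cube_autocorrelation M T (Suc l) (S i) (f i) h \<le> ?C + t"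
    using eventually_happens[of _ sequentially] by auto
  have avg_q: "(1 / real h)\<^sup>2 * (\<Sum>a<h. \<Sum>b<h. q (?g a b i)) \<le> root (2 ^ Suc l) ?C + D"
  proof -
    let ?A = "{..<h} \<times> {..<h}"
    have card: "real (card ?A) = (real h)\<^sup>2" by (simp add: power2_eq_square)
    have "(1 / real h)\<^sup>2 * (\<Sum>a<h. \<Sum>b<h. q (?g a b i)) =
        (\<Sum>p\<in>?A. root (2 ^ Suc l) (cube_integral M T (Suc l) (?g (fst p) (snd p) i))) / real (card ?A)"
      unfolding card by (simp add: q_def sum.cartesian_product split_def power_divide)
    also have "\<dots> \<le> root (2 ^ Suc l) ((\<Sum>p\<in>?A. cube_integral M T (Suc l) (?g (fst p) (snd p) i)) / real (card ?A))"
      using h(1) q0 by (intro root_average_le) (auto simp: lessThan_empty_iff)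
    also have "(\<Sum>p\<in>?A. cube_integral M T (Suc l) (?g (fst p) (snd p) i)) / real (card ?A) =
        cube_autocorrelation M T (Suc l) (S i) (f i) h"
      unfolding card cube_autocorrelation_def by (simp add: sum.cartesian_product split_def power_divide)
    also have "root (2 ^ Suc l) \<dots> \<le> root (2 ^ Suc l) (?C + t)" using h(2) by simp
    finally show ?thesis using t(2) by simp
  qed
  \<comment> \<open>This square matches the square on the left of the van der Corput
    inequality.\<close>
  have root2: "root (2 ^ Suc l) ?C = (cube_seminorm M T (Suc (Suc l)) (f i))\<^sup>2"
  proof -
    have "root (2 ^ Suc (Suc l)) ?C = sqrt (root (2 ^ Suc l) ?C)"
      by (simp add: sqrt_def real_root_mult_exp[symmetric])
    then show ?thesis using C0 by (simp add: cube_seminorm_eq)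
  qed
  have bounds: "\<bar>\<Prod>j\<in>J. f j ((S j ^^ n) x)\<bar> \<le> (\<Prod>j\<in>J. c j)" if "x \<in> space M" for n x
    unfolding abs_prod using Suc.prems(7) measure_preserving_funpow_space[OF mp that]
    by (intro prod_mono) auto
  have bm: "(\<lambda>x. \<Prod>j\<in>J. f j ((S j ^^ n) x)) \<in> bounded_measurable M" for n
    by (intro bounded_measurable_prod fS)
  have "eventually (\<lambda>m. (\<integral>x. ((1 / real m) * (\<Sum>n<m. \<Prod>j\<in>J. f j ((S j ^^ n) x)))\<^sup>2 \<partial>M)
         \<le> (1 / real h)\<^sup>2 * (\<Sum>a<h. \<Sum>b<h. K * q (?g a b i) + D) + D) sequentially"
    by (rule van_der_Corput[OF prob_space_axioms bm bounds h(1) D corr])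
  then show ?case
  proof eventually_elim
    case (elim m)
    let ?s = "cube_seminorm M T (Suc (Suc l)) (f i)"
    let ?P = "\<Prod>j\<in>J - {i}. c j"
    have P0: "?P \<ge> 0" using Suc.prems(8) by (intro prod_nonneg) auto
    have s0: "?s \<ge> 0" using C0 by (simp add: cube_seminorm_eq)
    have "(\<Sum>a<h. \<Sum>b<h. K * q (?g a b i) + D) = K * (\<Sum>a<h. \<Sum>b<h. q (?g a b i)) + (real h)\<^sup>2 * D"
      by (simp add: sum.distrib sum_distrib_left power2_eq_square)
    then have "(1 / real h)\<^sup>2 * (\<Sum>a<h. \<Sum>b<h. K * q (?g a b i) + D) + D =
        K * ((1 / real h)\<^sup>2 * (\<Sum>a<h. \<Sum>b<h. q (?g a b i))) + 2 * D"
      using h(1) by (simp add: algebra_simps power_divide)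
    also have "\<dots> \<le> K * (?s\<^sup>2 + D) + 2 * D"
      using avg_q K0 unfolding root2 by (intro add_right_mono mult_left_mono)
    also have "\<dots> = (?s * ?P)\<^sup>2 + e\<^sup>2"
    proof -
      have "D * (K + 2) = e\<^sup>2" using K0 by (simp add: D_def)
      then show ?thesis by (simp add: K_def algebra_simps power_mult_distrib)
    qed
    finally have "(\<integral>x. (multi_average J S f m x)\<^sup>2 \<partial>M) \<le> (?s * ?P)\<^sup>2 + e\<^sup>2"
      using elim unfolding multi_average_def by (rule order_trans[rotated])
    then have "L2_norm M (multi_average J S f m) \<le> sqrt ((?s * ?P)\<^sup>2 + e\<^sup>2)"
      unfolding L2_norm_def by simp
    also have "\<dots> \<le> sqrt ((?s * ?P)\<^sup>2) + sqrt (e\<^sup>2)"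
      by (intro sqrt_add_le_add_sqrt) auto
    finally show ?case using P0 s0 Suc.prems(9) by simp
  qed
qed

end

section \<open>Upper limits and essentially bounded functions\<close>

lemma limsup_ereal_le:
  fixes a :: "nat \<Rightarrow> real"
  assumes "\<And>e. e > 0 \<Longrightarrow> eventually (\<lambda>n. a n \<le> B + e) sequentially"
  shows "limsup (\<lambda>n. ereal (a n)) \<le> ereal B"
proof (rule ereal_le_epsilon2)
  fix e :: real assume "0 < e"
  from assms[OF this] show "limsup (\<lambda>n. ereal (a n)) \<le> ereal B + ereal e"
    by (intro Limsup_bounded) (auto elim!: eventually_mono)
qed

lemma Linf_norm_nonneg:
  assumes "f \<in> Linf M"
  shows "0 \<le> Linf_norm M f"
proof -
  obtain C where "AE x in M. \<bar>f x\<bar> \<le> C" using assms by (auto simp: Linf_def)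
  then have "AE x in M. \<bar>f x\<bar> \<le> max 0 C" by eventually_elim simp
  then show ?thesis unfolding Linf_norm_def by (intro cInf_greatest) (auto intro: exI[of _ "max 0 C"])
qed

text \<open>The infimum is attained: the bounds exceeding it by \<open>1 / real (Suc n)\<close> hold
  simultaneously outside a countable union of null sets.\<close>

lemma AE_le_Linf_norm:
  assumes "f \<in> Linf M"
  shows "AE x in M. \<bar>f x\<bar> \<le> Linf_norm M f"
proof -
  let ?X = "{C. 0 \<le> C \<and> (AE x in M. \<bar>f x\<bar> \<le> C)}"
  obtain C where "AE x in M. \<bar>f x\<bar> \<le> C" using assms by (auto simp: Linf_def)
  then have "AE x in M. \<bar>f x\<bar> \<le> max 0 C" by eventually_elim simp
  then have ne: "?X \<noteq> {}" by (auto intro: exI[of _ "max 0 C"])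
  have bdd: "bdd_below ?X" by (auto intro!: bdd_belowI[of _ 0])
  have "AE x in M. \<bar>f x\<bar> \<le> Linf_norm M f + 1 / real (Suc n)" for n
  proof -
    have "Inf ?X < Linf_norm M f + 1 / real (Suc n)" by (simp add: Linf_norm_def)
    then obtain C where "AE x in M. \<bar>f x\<bar> \<le> C" "C < Linf_norm M f + 1 / real (Suc n)"
      using cInf_less_iff[OF ne bdd] by auto
    then show ?thesis by (auto elim!: eventually_mono)
  qed
  then have "AE x in M. \<forall>n. \<bar>f x\<bar> \<le> Linf_norm M f + 1 / real (Suc n)" by (simp add: AE_all_countable)
  then show ?thesis
  proof eventually_elim
    case (elim x)
    have "(\<lambda>n. Linf_norm M f + 1 / real (Suc n)) \<longlonglongrightarrow> Linf_norm M f + 0"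
      by (intro tendsto_intros LIMSEQ_Suc[OF lim_const_over_n])
    then have "\<bar>f x\<bar> \<le> Linf_norm M f + 0" by (rule tendsto_lowerbound) (use elim in auto)
    then show ?case by simp
  qed
qed

lemma bounded_measurable_Linf: "bounded_measurable M \<subseteq> Linf M"
  by (auto simp: bounded_measurable_def Linf_def)

lemma AE_measure_preserving:
  assumes "measure_preserving_map M S" "AE x in M. P x"
  shows "AE x in M. P (S x)"
proof (rule AE_distrD[of S M M P])
  show "S \<in> measurable M M" "AE x in distr M M S. P x"
    using assms by (simp_all only: measure_preserving_map_def)
qed

text \<open>Exceptional sets stay null under preimages by the iterates, and only countably many
  iterates occur.\<close>

lemma L2_norm_multi_average_cong_AE:
  assumes J: "finite J" and S: "\<And>j. j \<in> J \<Longrightarrow> measure_preserving_map M (S j)"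
    and f: "\<And>j. j \<in> J \<Longrightarrow> f j \<in> borel_measurable M" and g: "\<And>j. j \<in> J \<Longrightarrow> g j \<in> borel_measurable M"
    and eq: "\<And>j. j \<in> J \<Longrightarrow> AE x in M. f j x = g j x"
  shows "L2_norm M (multi_average J S f N) = L2_norm M (multi_average J S g N)"
proof -
  have Sn: "(S j ^^ n) \<in> measurable M M" if "j \<in> J" for j n
    using measure_preserving_funpow[OF S[OF that]] by (simp add: measure_preserving_map_def)
  have "AE x in M. \<forall>j\<in>J. f j ((S j ^^ n) x) = g j ((S j ^^ n) x)" for n
    using J eq by (intro AE_finite_allI AE_measure_preserving[OF measure_preserving_funpow[OF S]]) auto
  then have "AE x in M. \<forall>n. \<forall>j\<in>J. f j ((S j ^^ n) x) = g j ((S j ^^ n) x)"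
    by (simp add: AE_all_countable)
  then have "AE x in M. (multi_average J S f N x)\<^sup>2 = (multi_average J S g N x)\<^sup>2"
    by eventually_elim (simp add: multi_average_def)
  moreover have "multi_average J S h N \<in> borel_measurable M" if "\<And>j. j \<in> J \<Longrightarrow> h j \<in> borel_measurable M" for h
    unfolding multi_average_def[abs_def]
    by (intro borel_measurable_times borel_measurable_const borel_measurable_sum borel_measurable_prod
        measurable_compose[OF Sn that]) auto
  ultimately show ?thesis
    unfolding L2_norm_def using f g by (intro arg_cong[of _ _ sqrt] integral_cong_AE) auto
qed

lemma multiple_average_eq: "multiple_average l T f N = multi_average {1..l} T f N"
  by (simp add: multiple_average_def multi_average_def fun_eq_iff)

context cube_system
begin

text \<open>Truncating \<open>f j\<close> at level \<open>c j\<close> changes it on a null set only,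
  which affects neither the norms of the averages nor the seminorm.\<close>

lemma multi_average_Linf_bound:
  assumes J: "finite J" "card J = Suc l" "i \<in> J" and S: "ergodic_family M J S"
    and com: "\<And>j. j \<in> J \<Longrightarrow> commuting_maps M (S j) T"
    and f: "\<And>j. j \<in> J \<Longrightarrow> f j \<in> Linf M" and c: "\<And>j. j \<in> J \<Longrightarrow> Linf_norm M (f j) \<le> c j" and e: "e > 0"
  shows "eventually (\<lambda>N. L2_norm M (multi_average J S f N) \<le>
           cube_seminorm M T (Suc l) (f i) * (\<Prod>j\<in>J - {i}. c j) + e) sequentially"
proof -
  define g where "g j x = max (- c j) (min (c j) (f j x))" for j x
  have mp: "measure_preserving_map M (S j)" if "j \<in> J" for j
    using S that by (simp add: ergodic_family_def ergodic_map_def)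
  have c0: "0 \<le> c j" if "j \<in> J" for j using Linf_norm_nonneg[OF f[OF that]] c[OF that] by simp
  have fm: "f j \<in> borel_measurable M" if "j \<in> J" for j using f[OF that] by (simp add: Linf_def)
  have gB: "\<bar>g j x\<bar> \<le> c j" if "j \<in> J" for j x using c0[OF that] by (auto simp: g_def abs_le_iff)
  have g: "g j \<in> bounded_measurable M" if "j \<in> J" for j
  proof -
    note [measurable] = fm[OF that]
    have "g j \<in> borel_measurable M" unfolding g_def[abs_def] by measurable
    then show ?thesis using gB[OF that] by (auto simp: bounded_measurable_def)
  qed
  have eq: "AE x in M. f j x = g j x" if "j \<in> J" for j
    using AE_le_Linf_norm[OF f[OF that]]
  proof eventually_elim
    case (elim x)
    then show ?case using c[OF that] by (simp add: g_def abs_le_iff)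
  qed
  have "L2_norm M (multi_average J S f N) = L2_norm M (multi_average J S g N)" for N
    using J(1) mp fm g eq by (intro L2_norm_multi_average_cong_AE) (auto dest: bounded_measurable_measurable)
  moreover have "cube_seminorm M T (Suc l) (f i) = cube_seminorm M T (Suc l) (g i)"
    using cube_integral_cong_AE[OF fm bounded_measurable_measurable[OF g] eq] J(3)
    by (simp add: cube_seminorm_eq)
  ultimately show ?thesis
    using multi_average_bound[OF J S com g gB c0 e] by simp
qed

text \<open>For \<open>A\<close> in \<open>Z\<close>, the part of \<open>1\<^sub>A \<circ> S\<close> orthogonal to \<open>Z\<close> has seminorm zero, hence so does its
  composition with \<open>S\<inverse>\<close>, which is therefore orthogonal to \<open>1\<^sub>A\<close>.\<close>

lemma Z_factor_preimage:
  assumes S: "invertible_measure_preserving M S" "commuting_maps M S T"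
    and Z: "subalgebra M Z"
    and char: "\<And>f. f \<in> Linf M \<Longrightarrow> (AE x in M. real_cond_exp M Z f x = 0) \<longleftrightarrow> cube_seminorm M T k f = 0"
    and A: "A \<in> sets Z"
  shows "\<exists>B\<in>sets Z. AE x in M. S x \<in> A \<longleftrightarrow> x \<in> B"
proof -
  let ?S' = "inv_into (space M) S"
  interpret Z: sigma_finite_subalgebra M Z by (rule sigma_finite_subalgebra_prob[OF prob_space_axioms Z])
  have mp: "measure_preserving_map M S" using S(1) by (simp add: invertible_measure_preserving_def)
  have mp': "measure_preserving_map M ?S'"
    using invertible_measure_preserving_inverse[OF S(1)] by (simp add: invertible_measure_preserving_def)
  have AM [measurable]: "A \<in> sets M" using A Z by (auto simp: subalgebra_def)
  have SM [measurable]: "S \<in> measurable M M" using mp by (simp add: measure_preserving_map_def)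
  have S'M: "?S' \<in> measurable M M" using mp' by (simp add: measure_preserving_map_def)
  define h where "h x = indicat_real A (S x)" for x
  have indA: "indicat_real A \<in> bounded_measurable M"
    by (auto simp: bounded_measurable_def indicator_def intro!: exI[of _ 1])
  have h: "h \<in> bounded_measurable M" unfolding h_def[abs_def] by (rule bounded_measurable_comp[OF indA SM])
  note hint = integrable_bounded_measurable[OF prob_space_axioms h]
  \<comment> \<open>A version of the conditional expectation with values between \<open>0\<close>
    and \<open>1\<close> everywhere, hence bounded and not only essentially so.\<close>
  define P where "P x = max 0 (min 1 (real_cond_exp M Z h x))" for x
  have PZ: "P \<in> borel_measurable Z" unfolding P_def[abs_def] by (intro borel_measurable_max borel_measurable_min) auto
  then have PM: "P \<in> borel_measurable M" by (rule measurable_from_subalg[OF Z])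
  have P: "P \<in> bounded_measurable M" using PM by (auto simp: bounded_measurable_def P_def intro!: exI[of _ 1])
  note Pint = integrable_bounded_measurable[OF prob_space_axioms P]
  have "AE x in M. 0 \<le> real_cond_exp M Z h x"
    by (rule Z.real_cond_exp_pos) (use bounded_measurable_measurable[OF h] in \<open>auto simp: h_def\<close>)
  moreover have "AE x in M. real_cond_exp M Z h x \<le> 1"
    by (rule Z.real_cond_exp_le_c) (use hint in \<open>auto simp: h_def\<close>)
  ultimately have hP: "AE x in M. real_cond_exp M Z h x = P x" by eventually_elim (simp add: P_def)
  define g where "g x = h x - P x" for x
  have g: "g \<in> bounded_measurable M" unfolding g_def[abs_def] using h P by blast
  have Eg: "AE x in M. real_cond_exp M Z g x = 0"
    using Z.real_cond_exp_diff[OF hint Pint] Z.real_cond_exp_F_meas[OF Pint PZ] hP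
    unfolding g_def[abs_def] by eventually_elim simp
  define g' where "g' x = g (?S' x)" for x
  have g': "g' \<in> bounded_measurable M" unfolding g'_def[abs_def] by (rule bounded_measurable_comp[OF g S'M])
  have "cube_seminorm M T k g = 0" using Eg char[of g] g bounded_measurable_Linf by auto
  \<comment> \<open>Cube integrals are invariant under the inverse of \<open>S\<close>, which
    commutes with \<open>T\<close> as well.\<close>
  then have "cube_seminorm M T k g' = 0"
    unfolding g'_def[abs_def] cube_seminorm_eq
    by (subst cube_integral_comp[OF mp' commuting_maps_inverse[OF S(1) T S(2)] g])
  then have Eg': "AE x in M. real_cond_exp M Z g' x = 0" using char[of g'] g' bounded_measurable_Linf by auto
  have orth: "(\<integral>x. k x * G x \<partial>M) = 0"
    if "AE x in M. real_cond_exp M Z G x = 0" "k \<in> borel_measurable Z" "k \<in> bounded_measurable M" "G \<in> bounded_measurable M"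
    for k G
  proof -
    have "(\<integral>x. k x * G x \<partial>M) = (\<integral>x. k x * real_cond_exp M Z G x \<partial>M)"
      using that integrable_bounded_measurable[OF prob_space_axioms bounded_measurable_mult[OF that(3,4)]]
      by (intro Z.real_cond_exp_intg(2)[symmetric]) (auto dest: bounded_measurable_measurable)
    also have "\<dots> = 0" using that(1) by (intro integral_eq_zero_AE) (auto elim!: eventually_mono)
    finally show ?thesis .
  qed
  have "(\<integral>x. h x * g x \<partial>M) = (\<integral>x. indicat_real A (S x) * g' (S x) \<partial>M)"
    using invertible_inverse(2)[OF S(1)]
    by (intro Bochner_Integration.integral_cong refl) (simp add: h_def g'_def)
  also have "\<dots> = (\<integral>x. indicat_real A x * g' x \<partial>M)"
    by (rule integral_measure_preserving[OF mp bounded_measurable_measurable[OF bounded_measurable_mult[OF indA g']]])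
  also have "\<dots> = 0" using A by (intro orth[OF Eg' _ indA g']) auto
  finally have hg: "(\<integral>x. h x * g x \<partial>M) = 0" .
  have Pg: "(\<integral>x. P x * g x \<partial>M) = 0" by (rule orth[OF Eg PZ P g])
  \<comment> \<open>\<open>g\<close> is orthogonal to both \<open>h\<close> and \<open>P\<close>,
    hence to their difference, which is \<open>g\<close> itself.\<close>
  have "(\<integral>x. (g x)\<^sup>2 \<partial>M) = (\<integral>x. h x * g x - P x * g x \<partial>M)"
    by (intro Bochner_Integration.integral_cong refl) (simp add: g_def power2_eq_square algebra_simps)
  also have "\<dots> = 0"
    using hg Pg integrable_bounded_measurable[OF prob_space_axioms bounded_measurable_mult[OF h g]]
      integrable_bounded_measurable[OF prob_space_axioms bounded_measurable_mult[OF P g]] by simp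
  finally have "AE x in M. (g x)\<^sup>2 = 0"
    using integral_nonneg_eq_0_iff_AE[of M "\<lambda>x. (g x)\<^sup>2"]
      integrable_bounded_measurable[OF prob_space_axioms bounded_measurable_power2[OF g]] by auto
  then have AEg: "AE x in M. h x = P x" by (auto elim!: eventually_mono simp: g_def)
  \<comment> \<open>\<open>h\<close> takes only the values \<open>0\<close> and \<open>1\<close>, so
    a threshold between them recovers the preimage of \<open>A\<close>.\<close>
  have "P -` {1/2<..} \<inter> space Z \<in> sets Z" by (rule measurable_sets[OF PZ]) simp
  moreover have "AE x in M. S x \<in> A \<longleftrightarrow> x \<in> P -` {1/2<..} \<inter> space Z"
    using AEg AE_space
  proof eventually_elim
    case (elim x)
    then have "x \<in> space Z" using Z by (simp add: subalgebra_def)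
    with elim show ?case by (cases "S x \<in> A") (auto simp: h_def)
  qed
  ultimately show ?thesis by blast
qed

text \<open>One half of the invariance is \<open>Z_factor_preimage\<close> for \<open>S\<close>; the
  other is the same lemma for the inverse map, pulled back along \<open>S\<close>.\<close>

lemma Z_factor_invariant:
  assumes S: "invertible_measure_preserving M S" "commuting_maps M S T"
    and Z: "is_Z_factor M T k Z"
  shows "invariant_subalgebra M S Z"
proof -
  have sub: "subalgebra M Z" using Z by (simp add: is_Z_factor_def invariant_subalgebra_def)
  have char: "(AE x in M. real_cond_exp M Z f x = 0) \<longleftrightarrow> cube_seminorm M T (Suc k) f = 0"
    if "f \<in> Linf M" for f using Z that by (simp add: is_Z_factor_def)
  let ?S' = "inv_into (space M) S"
  have S': "invertible_measure_preserving M ?S'" "commuting_maps M ?S' T"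
    using invertible_measure_preserving_inverse[OF S(1)] commuting_maps_inverse[OF S(1) T S(2)] by auto
  show ?thesis unfolding invariant_subalgebra_def
  proof (intro conjI ballI sub)
    fix A assume A: "A \<in> sets Z"
    show "\<exists>B\<in>sets Z. AE x in M. S x \<in> A \<longleftrightarrow> x \<in> B"
      by (rule Z_factor_preimage[OF S sub _ A]) (rule char)
  next
    fix B assume B: "B \<in> sets Z"
    have "\<exists>A\<in>sets Z. AE x in M. ?S' x \<in> B \<longleftrightarrow> x \<in> A"
      by (rule Z_factor_preimage[OF S' sub _ B]) (rule char)
    then obtain A where A: "A \<in> sets Z" "AE x in M. ?S' x \<in> B \<longleftrightarrow> x \<in> A"
      by blast
    have "AE x in M. ?S' (S x) \<in> B \<longleftrightarrow> S x \<in> A"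
      using S(1) A(2) by (intro AE_measure_preserving[of M S]) (auto simp: invertible_measure_preserving_def)
    then have "AE x in M. S x \<in> A \<longleftrightarrow> x \<in> B"
      using AE_space by eventually_elim (simp add: invertible_inverse[OF S(1)])
    with A(1) show "\<exists>A\<in>sets Z. AE x in M. S x \<in> A \<longleftrightarrow> x \<in> B" by blast
  qed
qed

end

text \<open>The averages are multilinear in the functions while the seminorm is homogeneous of
  degree one, so the general estimate carries the essential sup norms of the other functions; for
  norms at most \<open>1\<close> the plain minimum remains. An arbitrary member \<open>T p\<close>
  of the family serves as the base map of the cube measures.\<close>

theorem proposition3p2:
  fixes M :: "'a measure" and l :: nat and T :: "nat \<Rightarrow> 'a \<Rightarrow> 'a"
  assumes "prob_space M"
    and "l \<ge> 1"
    and "\<And>i. i \<in> {1..l} \<Longrightarrow> invertible_measure_preserving M (T i)"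
    and "\<And>i. i \<in> {1..l} \<Longrightarrow> ergodic_map M (T i)"
    and "\<And>i j. i \<in> {1..l} \<Longrightarrow> j \<in> {1..l} \<Longrightarrow> commuting_maps M (T i) (T j)"
    and "\<And>i j. i \<in> {1..l} \<Longrightarrow> j \<in> {1..l} \<Longrightarrow> i \<noteq> j \<Longrightarrow>
           ergodic_map M (T i \<circ> inv_into (space M) (T j))"
    and "\<And>i. i \<in> {1..l} \<Longrightarrow> has_cube_measures M (T i)"
  shows "(\<forall>f. \<forall>p\<in>{1..l}. (\<forall>i\<in>{1..l}. f i \<in> Linf M) \<longrightarrow>
            limsup (\<lambda>N. ereal (L2_norm M (multiple_average l T f N)))
              \<le> ereal (MIN i\<in>{1..l}. cube_seminorm M (T p) l (f i) *
                                       (\<Prod>j\<in>{1..l} - {i}. Linf_norm M (f j))) \<and>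
            ((\<forall>i\<in>{1..l}. Linf_norm M (f i) \<le> 1) \<longrightarrow>
               limsup (\<lambda>N. ereal (L2_norm M (multiple_average l T f N)))
                 \<le> ereal (MIN i\<in>{1..l}. cube_seminorm M (T p) l (f i))))
       \<and> (\<forall>p\<in>{1..l}. \<forall>Z. is_Z_factor M (T p) (l - 1) Z \<longrightarrow> characteristic_factor M l T Z)"
proof -
  let ?J = "{1..l}"
  have J: "finite ?J" "card ?J = Suc (l - 1)" "?J \<noteq> {}" using \<open>l \<ge> 1\<close> by auto
  have fam: "ergodic_family M ?J T" using assms by (auto simp: ergodic_family_def)
  have sys: "cube_system M (T p)" if "p \<in> ?J" for p
    using assms(1,7) assms(3)[OF that] that
    by (auto simp: cube_system_def cube_system_axioms_def invertible_measure_preserving_def)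
  have bound: "eventually (\<lambda>N. L2_norm M (multiple_average l T f N) \<le>
      cube_seminorm M (T p) l (f i) * (\<Prod>j\<in>?J - {i}. c j) + e) sequentially"
    if "p \<in> ?J" "i \<in> ?J" "\<forall>j\<in>?J. f j \<in> Linf M" "\<forall>j\<in>?J. Linf_norm M (f j) \<le> c j" "e > 0" for p i f c e
  proof -
    interpret cube_system M "T p" by (rule sys[OF that(1)])
    show ?thesis
      using multi_average_Linf_bound[OF J(1,2) that(2) fam, of f c e] that assms(2,5)
      by (simp add: multiple_average_eq)
  qed
  have Min_bound: "x \<le> ereal (Min (b ` ?J))" if "\<And>i. i \<in> ?J \<Longrightarrow> x \<le> ereal (b i)" for x b
  proof -
    have "Min (b ` ?J) \<in> b ` ?J" by (rule Min_in) (use J in blast)+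
    then obtain i where "i \<in> ?J" "Min (b ` ?J) = b i" by (rule imageE)
    then show ?thesis using that[of i] by simp
  qed
  show ?thesis
  proof (intro conjI allI ballI impI)
    fix f p assume p: "p \<in> ?J" and f: "\<forall>i\<in>?J. f i \<in> Linf M"
    show "limsup (\<lambda>N. ereal (L2_norm M (multiple_average l T f N)))
       \<le> ereal (MIN i\<in>?J. cube_seminorm M (T p) l (f i) * (\<Prod>j\<in>?J - {i}. Linf_norm M (f j)))"
      by (intro Min_bound limsup_ereal_le bound p f) auto
    assume norm: "\<forall>i\<in>?J. Linf_norm M (f i) \<le> 1"
    show "limsup (\<lambda>N. ereal (L2_norm M (multiple_average l T f N)))
       \<le> ereal (MIN i\<in>?J. cube_seminorm M (T p) l (f i))"
    proof (intro Min_bound limsup_ereal_le)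
      fix i e assume "i \<in> ?J" "(0::real) < e"
      \<comment> \<open>With every \<open>c j\<close> equal to \<open>1\<close> the product
        disappears.\<close>
      with bound[OF p this(1) f norm this(2)]
      show "eventually (\<lambda>N. L2_norm M (multiple_average l T f N) \<le> cube_seminorm M (T p) l (f i) + e) sequentially"
        by simp
    qed
  next
    fix p Z assume p: "p \<in> ?J" and Z: "is_Z_factor M (T p) (l - 1) Z"
    interpret cube_system M "T p" by (rule sys[OF p])
    show "characteristic_factor M l T Z"
      unfolding characteristic_factor_def
    proof (intro conjI allI ballI impI)
      fix i assume "i \<in> ?J"
      then show "invariant_subalgebra M (T i) Z" using p by (intro Z_factor_invariant[OF _ _ Z] assms(3,5))
    next
      fix f assume f: "\<forall>i\<in>?J. f i \<in> Linf M" and "\<exists>i\<in>?J. AE x in M. real_cond_exp M Z (f i) x = 0"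
      then obtain i where i: "i \<in> ?J" "AE x in M. real_cond_exp M Z (f i) x = 0" by blast
      \<comment> \<open>As \<open>l = Suc (l - 1)\<close>, the factor of index \<open>l - 1\<close>
        detects the seminorm of order \<open>l\<close>.\<close>
      then have "cube_seminorm M (T p) l (f i) = 0"
        using Z f \<open>l \<ge> 1\<close> unfolding is_Z_factor_def by (metis Suc_diff_1 Suc_le_eq One_nat_def)
      then have ev: "eventually (\<lambda>N. L2_norm M (multiple_average l T f N) \<le> e) sequentially" if "e > 0" for e
        using bound[OF p i(1) f, of "\<lambda>j. Linf_norm M (f j)" e] that by simp
      show "(\<lambda>N. L2_norm M (multiple_average l T f N)) \<longlonglongrightarrow> 0"
      proof (rule tendstoI)
        fix e :: real assume "e > 0"
        then show "eventually (\<lambda>N. dist (L2_norm M (multiple_average l T f N)) 0 < e) sequentially"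
          using ev[of "e / 2"] by (auto elim!: eventually_mono simp: L2_norm_def)
      qed
    qed
  qed
qed

end
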